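(* Let $T$ be braided, let $n\ge 2$, and let $\mathcal{I}_n\subset\mathcal{H}^{\otimes n}$ be a linear subspace generating a homogeneous Wick ideal of degree $n$. Then the subspace $$\mathcal{I}_{n+1}=(\mathbf{1}_{\mathcal{H}^{\otimes (n+1)}}-T_1T_2\cdots T_n)(\mathcal{I}_n\otimes\mathcal{H})\subset\mathcal{H}^{\otimes(n+1)}$$ generates a homogeneous Wick ideal of degree $n+1$.
   Context: Let $d\ge 1$ and let $\{T_{ij}^{kl}: i,j,k,l=1,\ldots,d\}\subset\mathbb{C}$ satisfy $T_{ji}^{lk}=\overline{T_{ij}^{kl}}$. The Wick algebra $W(T)$ is the unital $*$-algebra generated by $a_i,a_i^*$, $i=1,\ldots,d$, with relations $a_i^*a_j=\delta_{ij}1+\sum_{k,l=1}^d T_{ij}^{kl}a_la_k^*$. Let $\mathcal{H}$ be the $d$-dimensional Hilbert space with orthonormal basis $e_1,\ldots,e_d$, and $\mathcal{H}^*$ its formal dual with basis $e_1^*,\ldots,e_d^*$. Identify $e_i$ with $a_i$ and $e_i^*$ with $a_i^*$; the product of $W(T)$ is then written $\otimes$, and the full tensor algebras $\mathcal{T}(\mathcal{H})$, $\mathcal{T}(\mathcal{H}^* )$ are the subalgebras of $W(T)$ generated by the $a_i$, respectively by the $a_i^*$. For subspaces $U,V\subset W(T)$, $U\otimes V$ is the linear span of all products $u\otimes v$. A two-sided ideal $\mathcal{I}\subset\mathcal{T}(\mathcal{H})$ is a Wick ideal if $\mathcal{T}(\mathcal{H}^* )\otimes\mathcal{I}\subset\mathcal{I}\otimes\mathcal{T}(\mathcal{H}^*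 )$ in $W(T)$. If $\mathcal{I}$ is generated, as a two-sided ideal of $\mathcal{T}(\mathcal{H})$, by a subspace $\mathcal{I}_0\subset\mathcal{H}^{\otimes n}$, it is called a homogeneous Wick ideal of degree $n$. The (self-adjoint) operator $T:\mathcal{H}^{\otimes2}\to\mathcal{H}^{\otimes2}$ is $T(e_k\otimes e_l)=\sum_{i,j}T_{ik}^{lj}e_i\otimes e_j$. On a tensor power of $\mathcal{H}$, $T_i$ denotes $T$ acting in the $i$-th and $(i+1)$-st tensor factors and the identity elsewhere. $T$ is braided if $T_1T_2T_1=T_2T_1T_2$ on $\mathcal{H}^{\otimes3}$. *)

theory Defs
  imports Complex_Main "HOL-Library.Poly_Mapping" "HOL-Algebra.QuotRing" "HOL-Algebra.Module"
    "HOL-Algebra.Subrings" "HOL-Algebra.Algebraic_Closure_Type"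
begin

section \<open>Free algebras\<close>

text \<open>
  Lists form the free monoid under concatenation, so \<open>'x list \<Rightarrow>\<^sub>0 complex\<close> with the
  convolution product of \<^theory>\<open>HOL-Library.Poly_Mapping\<close> is the free unital complex algebra
  on \<open>'x\<close>, with the words \<open>single w 1\<close> as its linear basis.
\<close>

instantiation list :: (type) monoid_add
begin

definition zero_list :: "'a list" where "zero_list = []"

definition plus_list :: "'a list \<Rightarrow> 'a list \<Rightarrow> 'a list" where "plus_list u v = u @ v"

instance
  by standard (simp_all add: zero_list_def plus_list_def)

end

type_synonym 'x free_alg = "'x list \<Rightarrow>\<^sub>0 complex"

abbreviation word :: "'x list \<Rightarrow> 'x free_alg" where
  "word w \<equiv> Poly_Mapping.single w 1"

definition cscale :: "complex \<Rightarrow> 'x free_alg \<Rightarrow> 'x free_alg" where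
  "cscale c = Poly_Mapping.map ((*) c)"

lemma lookup_cscale [simp]: "Poly_Mapping.lookup (cscale c p) w = c * Poly_Mapping.lookup p w"
  unfolding cscale_def by transfer (simp add: when_def)

interpretation free_alg: vector_space "cscale :: complex \<Rightarrow> 'x free_alg \<Rightarrow> 'x free_alg"
  by standard (auto intro!: poly_mapping_eqI simp: lookup_add algebra_simps)

definition lin_extend :: "('x list \<Rightarrow> 'y free_alg) \<Rightarrow> 'x free_alg \<Rightarrow> 'y free_alg" where
  "lin_extend f p = (\<Sum>w\<in>Poly_Mapping.keys p. cscale (Poly_Mapping.lookup p w) (f w))"


section \<open>The Wick algebra\<close>

text \<open>The letters \<open>Gen i\<close> and \<open>Adj i\<close> stand for \<open>a\<^sub>i\<close> and its adjoint.\<close>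

datatype 'd letter = Gen 'd | Adj 'd

primrec letter_adj :: "'d letter \<Rightarrow> 'd letter" where
  "letter_adj (Gen i) = Adj i"
| "letter_adj (Adj i) = Gen i"

definition free_star :: "'d letter free_alg \<Rightarrow> 'd letter free_alg" where
  "free_star p = (\<Sum>w\<in>Poly_Mapping.keys p.
     cscale (cnj (Poly_Mapping.lookup p w)) (word (rev (map letter_adj w))))"

text \<open>Throughout, \<open>T i j k l\<close> is the coefficient with lower indices \<open>i j\<close> and upper indices \<open>k l\<close>.\<close>

type_synonym 'd wick_coeffs = "'d \<Rightarrow> 'd \<Rightarrow> 'd \<Rightarrow> 'd \<Rightarrow> complex"

definition hermitian_coeffs :: "'d wick_coeffs \<Rightarrow> bool" where
  "hermitian_coeffs T \<longleftrightarrow> (\<forall>i j k l. T j i l k = cnj (T i j k l))"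

definition wick_relation :: "'d::finite wick_coeffs \<Rightarrow> 'd \<Rightarrow> 'd \<Rightarrow> 'd letter free_alg" where
  "wick_relation T i j =
     word [Adj i] * word [Gen j]
       - ((if i = j then 1 else 0)
          + (\<Sum>k\<in>UNIV. \<Sum>l\<in>UNIV. cscale (T i j k l) (word [Gen l] * word [Adj k])))"

abbreviation free_ring :: "'x free_alg ring" where
  "free_ring \<equiv> ring_of_type_algebra"

abbreviation complex_ring :: "complex ring" where
  "complex_ring \<equiv> ring_of_type_algebra"

text \<open>The smallest two-sided ideal closed under the involution that contains the relations.\<close>

definition wick_relation_ideal :: "'d::finite wick_coeffs \<Rightarrow> 'd letter free_alg set" where
  "wick_relation_ideal T =
     \<Inter>{J. ideal J free_ring \<and> free_star ` J \<subseteq> J \<and> (\<forall>i j. wick_relation T i j \<in> J)}"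

definition wick_class :: "'d::finite wick_coeffs \<Rightarrow> 'd letter free_alg \<Rightarrow> 'd letter free_alg set" where
  "wick_class T p = wick_relation_ideal T +>\<^bsub>free_ring\<^esub> p"

definition wick_algebra ::
  "'d::finite wick_coeffs \<Rightarrow> (complex, 'd letter free_alg set) module" where
  "wick_algebra T =
     ring.extend (free_ring Quot wick_relation_ideal T)
       (module.fields (\<lambda>c C. \<Union>p\<in>C. wick_class T (cscale c p)))"

definition lin_span :: "(complex, 'w) module \<Rightarrow> 'w set \<Rightarrow> 'w set" where
  "lin_span W S = \<Inter>{V. submodule V complex_ring W \<and> S \<subseteq> V}"

definition tensor_in :: "(complex, 'w) module \<Rightarrow> 'w set \<Rightarrow> 'w set \<Rightarrow> 'w set" where
  "tensor_in W U V = lin_span W {u \<otimes>\<^bsub>W\<^esub> v | u v. u \<in> U \<and> v \<in> V}"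

definition generated_subalgebra :: "(complex, 'w) module \<Rightarrow> 'w set \<Rightarrow> 'w set" where
  "generated_subalgebra W S =
     \<Inter>{A. subring A W \<and> submodule A complex_ring W \<and> S \<subseteq> A}"

definition tensor_alg :: "'d::finite wick_coeffs \<Rightarrow> 'd letter free_alg set set" where
  "tensor_alg T = generated_subalgebra (wick_algebra T) {wick_class T (word [Gen i]) | i. True}"

definition tensor_alg_dual :: "'d::finite wick_coeffs \<Rightarrow> 'd letter free_alg set set" where
  "tensor_alg_dual T = generated_subalgebra (wick_algebra T) {wick_class T (word [Adj i]) | i. True}"

abbreviation tensor_alg_ring ::
  "'d::finite wick_coeffs \<Rightarrow> (complex, 'd letter free_alg set) module" where
  "tensor_alg_ring T \<equiv> (wick_algebra T)\<lparr>carrier := tensor_alg T\<rparr>"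

definition wick_ideal :: "'d::finite wick_coeffs \<Rightarrow> 'd letter free_alg set set \<Rightarrow> bool" where
  "wick_ideal T I \<longleftrightarrow>
     ideal I (tensor_alg_ring T) \<and>
     tensor_in (wick_algebra T) (tensor_alg_dual T) I
       \<subseteq> tensor_in (wick_algebra T) I (tensor_alg_dual T)"


section \<open>Tensor powers and homogeneous Wick ideals\<close>

text \<open>
  The tensor powers of \<open>\<H>\<close>, on which \<open>T\<close> acts, are the graded pieces of the free algebra on
  \<open>'d\<close>, whose product is the tensor product. \<open>tensor_embed\<close> is the identification of
  \<open>e\<^sub>i\<close> with \<open>a\<^sub>i\<close>.
\<close>

definition tensor_power :: "nat \<Rightarrow> 'd free_alg set" where
  "tensor_power n = {x. \<forall>w\<in>Poly_Mapping.keys x. length w = n}"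

definition tensor_prod :: "'d free_alg set \<Rightarrow> 'd free_alg set \<Rightarrow> 'd free_alg set" where
  "tensor_prod U V = free_alg.span {u * v | u v. u \<in> U \<and> v \<in> V}"

definition tensor_embed :: "'d::finite wick_coeffs \<Rightarrow> 'd free_alg \<Rightarrow> 'd letter free_alg set" where
  "tensor_embed T x = wick_class T (lin_extend (\<lambda>w. word (map Gen w)) x)"

definition generates_homogeneous_wick_ideal ::
  "'d::finite wick_coeffs \<Rightarrow> nat \<Rightarrow> 'd free_alg set \<Rightarrow> bool" where
  "generates_homogeneous_wick_ideal T n I0 \<longleftrightarrow>
     free_alg.subspace I0 \<and> I0 \<subseteq> tensor_power n \<and>
     wick_ideal T (genideal (tensor_alg_ring T) (tensor_embed T ` I0))"


section \<open>The operator \<open>T\<close>\<close>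

text \<open>
  Off \<open>\<H> \<otimes> \<H>\<close> the operator is extended by \<open>0\<close>.
\<close>

definition wick_op :: "'d::finite wick_coeffs \<Rightarrow> 'd free_alg \<Rightarrow> 'd free_alg" where
  "wick_op T = lin_extend (\<lambda>w. case w of
      [k, l] \<Rightarrow> (\<Sum>i\<in>UNIV. \<Sum>j\<in>UNIV. cscale (T i k l j) (word [i] * word [j]))
    | _ \<Rightarrow> 0)"

text \<open>
  Tensor positions are counted from \<open>1\<close>; only indices \<open>i\<close> between \<open>1\<close> and \<open>m - 1\<close> are meaningful
  on the \<open>m\<close>-th tensor power.
\<close>

definition wick_op_at :: "'d::finite wick_coeffs \<Rightarrow> nat \<Rightarrow> 'd free_alg \<Rightarrow> 'd free_alg" where
  "wick_op_at T i = lin_extend (\<lambda>w.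
     word (take (i - 1) w) * wick_op T (word (take 2 (drop (i - 1) w))) * word (drop (i + 1) w))"

definition braided :: "'d::finite wick_coeffs \<Rightarrow> bool" where
  "braided T \<longleftrightarrow> (\<forall>x\<in>tensor_power 3.
     wick_op_at T 1 (wick_op_at T 2 (wick_op_at T 1 x))
       = wick_op_at T 2 (wick_op_at T 1 (wick_op_at T 2 x)))"

text \<open>The composition of \<open>T\<^sub>1, \<dots>, T\<^sub>n\<close> in this order, so \<open>T\<^sub>n\<close> is applied first.\<close>

definition wick_op_prod :: "'d::finite wick_coeffs \<Rightarrow> nat \<Rightarrow> 'd free_alg \<Rightarrow> 'd free_alg" where
  "wick_op_prod T n = foldr (\<circ>) (map (wick_op_at T) [1..<n + 1]) id"

end

theory Submission
  imports Defs
begin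

text \<open>
  Moving \<open>a\<^sub>i\<^sup>*\<close> to the right past a tensor \<open>x\<close> gives
  \<open>a\<^sub>i\<^sup>* x = annih i x + (\<Sum>k. twist i k x \<otimes> a\<^sub>k\<^sup>*)\<close>, where \<open>annih i\<close> lowers the degree by one and
  \<open>twist i k\<close> preserves it. A faithful enough module of \<open>W(T)\<close> shows that these two components can
  be read off from the class of \<open>a\<^sub>i\<^sup>* x\<close>; hence, for degree reasons, a subspace \<open>I\<close> of
  \<open>\<H>\<^sup>\<otimes>\<^sup>n\<close> generates a Wick ideal iff every \<open>annih i\<close> vanishes on \<open>I\<close> and every \<open>twist i k\<close>
  maps \<open>I\<close> into itself. Since \<open>T\<^sub>1 \<cdots> T\<^sub>n (x \<otimes> e\<^sub>k) = (\<Sum>i. e\<^sub>i \<otimes> twist i k x)\<close>, the first condition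
  for the new subspace is a telescoping computation, and the second one follows from the quadratic
  relations between the \<open>twist i k\<close> that the braid relation implies.
\<close>

section \<open>Linear maps on free algebras\<close>

text \<open>\<open>W(T)\<close> is a quotient, so identities there hold only modulo the relation
  ideal, and an element of the ideal times the dual tensor algebra has no visible components. Acting
  on the vacuum vector of the module recovers two components of a_i^* x, of degrees
  \<open>n - 1\<close> and \<open>n\<close>. The two-sided ideal generated by \<open>I\<close> is
  \<open>I\<close> in degree \<open>n\<close> and zero below; this forces
  \<open>annih i x = 0\<close> and \<open>twist i k x \<in> I\<close>.

  The relation ideal is moreover closed under the involution. Self-adjointness of \<open>T\<close>
  makes the involution permute the relations, and so the module survives the quotient.

  The maps \<open>twist i k\<close> are the entries of an algebra homomorphism from the tensor
  algebra to matrices over it, and their quadratic relations are of RTT type. They express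
  \<open>twist i j\<close> of a generator (1 - T_1...T_n)(x \<otimes> e_k) by generators built from
  \<open>twist i p x\<close>, with coefficients taken from \<open>T\<close>.\<close>

abbreviation flin :: "('x free_alg \<Rightarrow> 'y free_alg) \<Rightarrow> bool" where
  "flin \<equiv> Vector_Spaces.linear cscale cscale"

lemma flinI:
  assumes "\<And>x y. f (x + y) = f x + f y" and "\<And>c x. f (cscale c x) = cscale c (f x)"
  shows "flin f"
  using assms by (unfold_locales) auto

lemmas flin_add = module_hom.add[OF Vector_Spaces.linear.axioms(3)]
lemmas flin_scale = module_hom.scale[OF Vector_Spaces.linear.axioms(3)]
lemmas flin_zero = module_hom.zero[OF Vector_Spaces.linear.axioms(3)]
lemmas flin_diff = module_hom.diff[OF Vector_Spaces.linear.axioms(3)]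
lemmas flin_sum = module_hom.sum[OF Vector_Spaces.linear.axioms(3)]

lemma cscale_conv_mult: "cscale c p = Poly_Mapping.single 0 c * p"
  unfolding cscale_def by (rule mult_map_scale_conv_mult)

lemma word_mult [simp]: "word u * word v = word (u @ v)"
  by (simp add: mult_single plus_list_def)

lemma word_Nil [simp]: "word [] = 1"
  using single_one[where ?'a = "'a list" and ?'b = complex] by (simp add: zero_list_def)

lemma sum_words: "(\<Sum>w\<in>Poly_Mapping.keys p. cscale (Poly_Mapping.lookup p w) (word w)) = p"
  by (intro poly_mapping_eqI)
     (auto simp: lookup_sum lookup_single when_def in_keys_iff if_distrib cong: if_cong)

lemma tensor_power_induct [consumes 1, case_names word zero add scale]:
  assumes "p \<in> tensor_power n"
    and "\<And>w. length w = n \<Longrightarrow> P (word w)" and "P 0"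
    and "\<And>p q. P p \<Longrightarrow> P q \<Longrightarrow> P (p + q)" and "\<And>c p. P p \<Longrightarrow> P (cscale c p)"
  shows "P p"
proof -
  have "P (\<Sum>w\<in>A. cscale (Poly_Mapping.lookup p w) (word w))"
    if "finite A" "\<And>w. w \<in> A \<Longrightarrow> length w = n" for A
    using that by (induction A rule: finite_induct) (auto intro: assms)
  from this[of "Poly_Mapping.keys p"] assms(1) show ?thesis
    by (simp add: sum_words tensor_power_def)
qed

lemma free_alg_induct [case_names word zero add scale]:
  assumes "\<And>w. P (word w)" and "P 0"
    and "\<And>p q. P p \<Longrightarrow> P q \<Longrightarrow> P (p + q)" and "\<And>c p. P p \<Longrightarrow> P (cscale c p)"
  shows "P p"
proof -
  have "P (\<Sum>w\<in>A. cscale (Poly_Mapping.lookup p w) (word w))" if "finite A" for A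
    using that by (induction A rule: finite_induct) (auto intro: assms)
  from this[of "Poly_Mapping.keys p"] show ?thesis
    by (simp add: sum_words)
qed

lemma cscale_mult_left: "cscale c p * q = cscale c (p * q)"
  by (simp add: cscale_conv_mult mult.assoc)

text \<open>A scalar is a multiple of the empty word, the unit of the free monoid, hence
  central.\<close>

lemma mult_cscale_right: "p * cscale c q = cscale c (p * q)"
proof -
  have "p * Poly_Mapping.single 0 c = Poly_Mapping.single 0 c * p"
  proof (induction p rule: free_alg_induct)
    case (word w)
    show ?case by (simp add: mult_single zero_list_def plus_list_def)
  next
    case (scale d p)
    have "Poly_Mapping.single 0 d * Poly_Mapping.single 0 c
        = Poly_Mapping.single 0 c * (Poly_Mapping.single 0 d :: 'a free_alg)"
      by (simp add: mult_single mult.commute)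
    with scale show ?case by (metis cscale_conv_mult mult.assoc)
  qed (simp_all add: algebra_simps)
  then show ?thesis by (simp add: cscale_conv_mult flip: mult.assoc)
qed

lemmas cscale_mult = cscale_mult_left mult_cscale_right

lemma flin_lin_extend: "flin (lin_extend f)"
proof (rule flinI)
  \<comment> \<open>The defining sum runs over the support of \<open>p\<close>; a common finite
    superset makes the sums for \<open>x\<close>, \<open>y\<close> and \<open>x + y\<close>
    comparable.\<close>
  have eq: "lin_extend f p = (\<Sum>w\<in>A. cscale (Poly_Mapping.lookup p w) (f w))"
    if "finite A" "Poly_Mapping.keys p \<subseteq> A" for p A
    unfolding lin_extend_def using that
    by (intro sum.mono_neutral_left) (auto simp: in_keys_iff)
  show "lin_extend f (x + y) = lin_extend f x + lin_extend f y" for x y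
    using Poly_Mapping.keys_add[of x y]
    by (simp add: eq[of "Poly_Mapping.keys x \<union> Poly_Mapping.keys y"] lookup_add
        free_alg.scale_left_distrib sum.distrib)
  show "lin_extend f (cscale c x) = cscale c (lin_extend f x)" for c x
  proof -
    have "Poly_Mapping.keys (cscale c x) \<subseteq> Poly_Mapping.keys x"
      by (auto simp: in_keys_iff)
    then show ?thesis
      by (simp add: eq[of "Poly_Mapping.keys x"] free_alg.scale_sum_right)
  qed
qed

lemma lin_extend_word [simp]: "lin_extend f (word w) = f w"
  by (simp add: lin_extend_def)

lemmas lin_extend_add [simp] = flin_add[OF flin_lin_extend]
lemmas lin_extend_scale [simp] = flin_scale[OF flin_lin_extend]
lemmas lin_extend_zero [simp] = flin_zero[OF flin_lin_extend]
lemmas lin_extend_diff [simp] = flin_diff[OF flin_lin_extend]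
lemmas lin_extend_sum = flin_sum[OF flin_lin_extend]

lemma span_image_subset:
  assumes "flin f" "free_alg.subspace V" "\<And>x. x \<in> S \<Longrightarrow> f x \<in> V" "x \<in> free_alg.span S"
  shows "f x \<in> V"
  using assms(4)
  by (induction rule: free_alg.span_induct_alt)
     (simp_all add: assms flin_zero[OF assms(1)] flin_add[OF assms(1)] flin_scale[OF assms(1)]
       free_alg.subspace_0 free_alg.subspace_add free_alg.subspace_scale)

lemma subspace_image:
  assumes "flin f" "free_alg.subspace V"
  shows "free_alg.subspace (f ` V)"
  using assms(2) unfolding free_alg.subspace_def
  by (auto simp flip: flin_zero[OF assms(1)] flin_add[OF assms(1)] flin_scale[OF assms(1)])

lemma flin_compose: "flin f \<Longrightarrow> flin g \<Longrightarrow> flin (\<lambda>x. g (f x))"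
  by (rule flinI)
     (simp_all add: flin_add[where f = f] flin_add[where f = g] flin_scale[where f = f] flin_scale[where f = g])

lemma flin_mult_right: "flin (\<lambda>x. x * y)"
  by (rule flinI) (simp_all add: distrib_right cscale_mult)

lemma flin_mult_left: "flin (\<lambda>x. y * x)"
  by (rule flinI) (simp_all add: distrib_left cscale_mult)

lemma flin_subtract: "flin f \<Longrightarrow> flin g \<Longrightarrow> flin (\<lambda>x. f x - g x)"
  by (rule flinI)
     (simp_all add: flin_add[where f = f] flin_add[where f = g] flin_scale[where f = f] flin_scale[where f = g]
       free_alg.scale_right_diff_distrib)

lemma flin_id: "flin (\<lambda>x. x)"
  by (rule flinI) simp_all


section \<open>Tensor powers\<close>

lemma subspace_tensor_power: "free_alg.subspace (tensor_power n)"
  unfolding free_alg.subspace_def tensor_power_def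
  using Poly_Mapping.keys_add by (fastforce simp: in_keys_iff)

lemma word_in_tensor_power [simp]: "word w \<in> tensor_power n \<longleftrightarrow> length w = n"
  by (simp add: tensor_power_def)

lemma mult_in_tensor_power:
  assumes "x \<in> tensor_power m" "y \<in> tensor_power n"
  shows "x * y \<in> tensor_power (m + n)"
  using assms keys_mult[of x y] by (fastforce simp: tensor_power_def plus_list_def)

lemma mult_in_tensor_power':
  assumes "x \<in> tensor_power m" "y \<in> tensor_power n" "m + n = k"
  shows "x * y \<in> tensor_power k"
  using mult_in_tensor_power[OF assms(1,2)] assms(3) by simp


section \<open>Moving an annihilator past a tensor\<close>

context
  fixes T :: "'d::finite wick_coeffs"
begin

text \<open>The factor to the left of a_k^* in the Wick relation for a_i^* a_j.\<close>

definition exch :: "'d \<Rightarrow> 'd \<Rightarrow> 'd \<Rightarrow> 'd free_alg" where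
  "exch i j k = (\<Sum>l\<in>UNIV. cscale (T i j k l) (word [l]))"

text \<open>The Wick relation is applied to the first letter: either the annihilator is absorbed
  there, or some a_k^* emerges and continues through the rest. In \<open>twist_word i m\<close> the
  index \<open>m\<close> belongs to the annihilator that emerges at the far right.\<close>

primrec annih_word :: "'d \<Rightarrow> 'd list \<Rightarrow> 'd free_alg" where
  "annih_word i [] = 0"
| "annih_word i (j # w) =
     (if i = j then word w else 0) + (\<Sum>k\<in>UNIV. exch i j k * annih_word k w)"

primrec twist_word :: "'d \<Rightarrow> 'd \<Rightarrow> 'd list \<Rightarrow> 'd free_alg" where
  "twist_word i m [] = (if i = m then 1 else 0)"
| "twist_word i m (j # w) = (\<Sum>k\<in>UNIV. exch i j k * twist_word k m w)"

text \<open>In normally ordered form,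
  \<open>a\<^sub>i\<^sup>* x = annih i x + (\<Sum>k. twist i k x \<otimes> a\<^sub>k\<^sup>*)\<close> for \<open>x\<close> in the tensor algebra.\<close>

definition annih :: "'d \<Rightarrow> 'd free_alg \<Rightarrow> 'd free_alg" where
  "annih i = lin_extend (annih_word i)"

definition twist :: "'d \<Rightarrow> 'd \<Rightarrow> 'd free_alg \<Rightarrow> 'd free_alg" where
  "twist i m = lin_extend (twist_word i m)"

lemma flin_annih: "flin (annih i)"
  unfolding annih_def by (rule flin_lin_extend)

lemma flin_twist: "flin (twist i m)"
  unfolding twist_def by (rule flin_lin_extend)

lemmas annih_linear [simp] =
  flin_add[OF flin_annih] flin_scale[OF flin_annih] flin_zero[OF flin_annih] flin_diff[OF flin_annih]
lemmas twist_linear [simp] =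
  flin_add[OF flin_twist] flin_scale[OF flin_twist] flin_zero[OF flin_twist] flin_diff[OF flin_twist]

lemma annih_one [simp]: "annih i 1 = 0"
  using lin_extend_word[of "annih_word i" "[]"] by (simp add: annih_def)

lemma twist_one: "twist i m 1 = (if i = m then 1 else 0)"
  using lin_extend_word[of "twist_word i m" "[]"] by (simp add: twist_def)

lemma annih_letter_mult:
  "annih i (word [j] * x) = (if i = j then x else 0) + (\<Sum>k\<in>UNIV. exch i j k * annih k x)"
proof (induction x rule: free_alg_induct)
  case (add p q)
  then show ?case by (simp add: distrib_left sum.distrib)
next
  case (scale c p)
  then show ?case by (simp add: cscale_mult free_alg.scale_sum_right free_alg.scale_right_distrib)
qed (simp_all add: annih_def)

lemma twist_letter_mult:
  "twist i m (word [j] * x) = (\<Sum>k\<in>UNIV. exch i j k * twist k m x)"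
proof (induction x rule: free_alg_induct)
  case (add p q)
  then show ?case by (simp add: distrib_left sum.distrib)
next
  case (scale c p)
  then show ?case by (simp add: cscale_mult free_alg.scale_sum_right)
qed (simp_all add: twist_def)

lemma word_Cons: "word (j # w) = word [j] * word w"
  by simp

lemma annih_letter: "annih i (word [j]) = (if i = j then 1 else 0)"
  using annih_letter_mult[of i j 1] by simp

lemma twist_letter: "twist i m (word [j]) = exch i j m"
  using twist_letter_mult[of i m j 1]
  by (simp add: twist_one if_distrib cong: if_cong)

text \<open>Passing a product means passing \<open>x\<close>, with a_k^* emerging, and then
  \<open>y\<close>. Together with \<open>twist_one\<close> this is the unital homomorphism into
  matrices.\<close>

lemma twist_mult: "twist i m (x * y) = (\<Sum>k\<in>UNIV. twist i k x * twist k m y)"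
proof (induction x rule: free_alg_induct)
  case (word w)
  show ?case
  proof (induction w arbitrary: i)
    case Nil
    show ?case by (simp add: twist_one if_distrib[of "\<lambda>a. a * _"] cong: if_cong)
  next
    case (Cons j w)
    have "twist i m (word (j # w) * y) = (\<Sum>k\<in>UNIV. exch i j k * twist k m (word w * y))"
      by (simp only: word_Cons[of j w] mult.assoc twist_letter_mult)
    also have "\<dots> = (\<Sum>k\<in>UNIV. \<Sum>l\<in>UNIV. exch i j k * twist k l (word w) * twist l m y)"
      by (simp add: Cons.IH sum_distrib_left mult.assoc)
    also have "\<dots> = (\<Sum>l\<in>UNIV. twist i l (word (j # w)) * twist l m y)"
      by (subst sum.swap) (simp only: word_Cons[of j w] twist_letter_mult sum_distrib_right)
    finally show ?case .
  qed
next
  case (add p q)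
  then show ?case by (simp add: distrib_right sum.distrib)
next
  case (scale c p)
  then show ?case by (simp add: cscale_mult free_alg.scale_sum_right)
qed simp

text \<open>A twisted Leibniz rule: the annihilator is absorbed within \<open>x\<close>, or it
  leaves \<open>x\<close> as a_k^* and is absorbed within \<open>y\<close>.\<close>

lemma annih_mult: "annih i (x * y) = annih i x * y + (\<Sum>k\<in>UNIV. twist i k x * annih k y)"
proof (induction x rule: free_alg_induct)
  case (word w)
  show ?case
  proof (induction w arbitrary: i)
    case Nil
    show ?case by (simp add: twist_one if_distrib[of "\<lambda>a. a * _"] cong: if_cong)
  next
    case (Cons j w)
    have "annih i (word (j # w) * y)
        = (if i = j then word w * y else 0) + (\<Sum>k\<in>UNIV. exch i j k * annih k (word w * y))"
      by (simp only: word_Cons[of j w] mult.assoc annih_letter_mult)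
    also have "\<dots> = annih i (word (j # w)) * y
        + (\<Sum>k\<in>UNIV. \<Sum>l\<in>UNIV. exch i j k * twist k l (word w) * annih l y)"
      by (simp add: Cons.IH sum_distrib_left distrib_left sum.distrib)
         (simp only: word_Cons[of j w] annih_letter_mult sum_distrib_right distrib_right mult.assoc, simp)
    also have "(\<Sum>k\<in>UNIV. \<Sum>l\<in>UNIV. exch i j k * twist k l (word w) * annih l y)
        = (\<Sum>l\<in>UNIV. twist i l (word (j # w)) * annih l y)"
      by (subst sum.swap) (simp only: word_Cons[of j w] twist_letter_mult sum_distrib_right)
    finally show ?case .
  qed
next
  case (add p q)
  then show ?case by (simp add: distrib_right sum.distrib)
next
  case (scale c p)
  then show ?case by (simp add: cscale_mult free_alg.scale_sum_right free_alg.scale_right_distrib)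
qed simp

lemma exch_in_tensor_power: "exch i j k \<in> tensor_power 1"
  unfolding exch_def
  by (intro free_alg.subspace_sum free_alg.subspace_scale subspace_tensor_power) simp

lemma twist_in_tensor_power:
  assumes "x \<in> tensor_power n"
  shows "twist i m x \<in> tensor_power n"
proof -
  have *: "twist i m (word w) \<in> tensor_power (length w)" for w
  proof (induction w arbitrary: i)
    case Nil
    show ?case using word_in_tensor_power[of "[] :: 'd list" 0]
      by (simp add: twist_one free_alg.subspace_0[OF subspace_tensor_power])
  next
    case (Cons j w)
    have "exch i j k * twist k m (word w) \<in> tensor_power (length (j # w))" for k
      by (rule mult_in_tensor_power'[OF exch_in_tensor_power Cons.IH]) simp
    then show ?case
      unfolding word_Cons[of j w] twist_letter_mult
      by (intro free_alg.subspace_sum subspace_tensor_power)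
  qed
  show ?thesis
    using assms by (induction rule: tensor_power_induct)
      (use * in \<open>auto simp: free_alg.subspace_0 free_alg.subspace_add free_alg.subspace_scale
        subspace_tensor_power\<close>)
qed

text \<open>For \<open>n = 0\<close> the truncated \<open>n - 1\<close> is harmless, because
  \<open>annih\<close> vanishes on scalars.\<close>

lemma annih_in_tensor_power:
  assumes "x \<in> tensor_power n"
  shows "annih i x \<in> tensor_power (n - 1)"
proof -
  have *: "annih i (word w) \<in> tensor_power (length w - 1)" for w
  proof (induction w arbitrary: i)
    case Nil
    show ?case by (simp add: free_alg.subspace_0[OF subspace_tensor_power])
  next
    case (Cons j w)
    have "exch i j k * annih k (word w) \<in> tensor_power (length w)" for k
    \<comment> \<open>\<open>1 + (length w - 1)\<close> is \<open>length w\<close> only for nonempty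
      \<open>w\<close>; for the empty word the summand is zero.\<close>
    proof (cases "w = []")
      case True
      then show ?thesis by (simp add: free_alg.subspace_0[OF subspace_tensor_power])
    next
      case False
      then show ?thesis
        by (intro mult_in_tensor_power'[OF exch_in_tensor_power Cons.IH]) (cases w; simp)
    qed
    then show ?case
      unfolding word_Cons[of j w] annih_letter_mult
      by (intro free_alg.subspace_add free_alg.subspace_sum subspace_tensor_power)
         (auto simp: free_alg.subspace_0[OF subspace_tensor_power])
  qed
  show ?thesis
    using assms by (induction rule: tensor_power_induct)
      (use * in \<open>auto simp: free_alg.subspace_0 free_alg.subspace_add free_alg.subspace_scale
        subspace_tensor_power\<close>)
qed

end


section \<open>The operators \<open>T\<^sub>i\<close>\<close>

lemma flin_wick_op_at: "flin (wick_op_at T i)"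
  unfolding wick_op_at_def by (rule flin_lin_extend)

lemmas wick_op_at_linear [simp] =
  flin_add[OF flin_wick_op_at] flin_scale[OF flin_wick_op_at] flin_zero[OF flin_wick_op_at]

text \<open>In \<open>T i j k l\<close> the incoming letters of the operator are \<open>j\<close>
  and \<open>k\<close>, so its second outgoing factor is the \<open>exch\<close> of the Wick
  relation. This ties the operator to the algebra.\<close>

lemma wick_op_at_first:
  "wick_op_at T 1 (word [j] * (word [k] * y)) = (\<Sum>i\<in>UNIV. word [i] * (exch T i j k * y))"
proof (induction y rule: free_alg_induct)
  case (word w)
  have "word [j] * (word [k] * word w) = word (j # k # w)"
    by simp
  then show ?case
    by (simp add: wick_op_at_def wick_op_def numeral_2_eq_2 exch_def
        sum_distrib_left sum_distrib_right cscale_mult)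
next
  case (scale c p)
  then show ?case by (simp add: cscale_mult free_alg.scale_sum_right)
qed (simp_all add: distrib_left sum.distrib)

text \<open>Positions count from 1; for \<open>i = 0\<close> the truncated \<open>i - 1\<close>
  would break the shift.\<close>

lemma wick_op_at_Suc:
  assumes "i \<ge> 1"
  shows "wick_op_at T (Suc i) (word [j] * y) = word [j] * wick_op_at T i y"
proof (induction y rule: free_alg_induct)
  case (word w)
  obtain m where "i = Suc m"
    using assms by (cases i) auto
  moreover have "word [j] * word w = word (j # w)"
    by simp
  ultimately show ?case
    by (simp add: wick_op_at_def flip: mult.assoc)
next
  case (scale c p)
  then show ?case by (simp add: cscale_mult)
qed (simp_all add: distrib_left)

section \<open>The product T_1...T_n\<close>

lemma flin_foldr_comp:
  assumes "\<And>f. f \<in> set fs \<Longrightarrow> flin f"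
  shows "flin (foldr (\<circ>) fs id)"
  using assms
proof (induction fs)
  case Nil
  show ?case using flin_id by (simp add: id_def)
next
  case (Cons f fs)
  have "flin (f \<circ> foldr (\<circ>) fs id)"
    unfolding comp_def[of f]
    by (rule flin_compose[of "foldr (\<circ>) fs id" f]) (use Cons.prems in \<open>auto intro!: Cons.IH\<close>)
  moreover have "foldr (\<circ>) (f # fs) id = f \<circ> foldr (\<circ>) fs id"
    by simp
  ultimately show ?case by (simp only:)
qed

lemma flin_wick_op_prod: "flin (wick_op_prod T n)"
  unfolding wick_op_prod_def by (rule flin_foldr_comp) (auto intro: flin_wick_op_at)

lemmas wick_op_prod_linear [simp] =
  flin_add[OF flin_wick_op_prod] flin_scale[OF flin_wick_op_prod] flin_zero[OF flin_wick_op_prod]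

lemma foldr_wick_op_at_Suc:
  assumes "\<And>i. i \<in> set is \<Longrightarrow> i \<ge> 1"
  shows "foldr (\<circ>) (map (wick_op_at T) (map Suc is)) id (word [j] * y)
       = word [j] * foldr (\<circ>) (map (wick_op_at T) is) id y"
  using assms by (induction "is") (simp_all add: wick_op_at_Suc)

text \<open>The factors T_2, ..., T_(n+1) leave the first letter alone and act behind it as T_1,
  ..., T_n.\<close>

lemma wick_op_prod_Suc:
  "wick_op_prod T (Suc n) (word [j] * y) = wick_op_at T 1 (word [j] * wick_op_prod T n y)"
proof -
  have "[1..<Suc n + 1] = 1 # map Suc [1..<n + 1]"
    by (simp add: upt_conv_Cons map_Suc_upt)
  then show ?thesis
    using foldr_wick_op_at_Suc[of "[1..<n + 1]" T j y]
    unfolding wick_op_prod_def by (simp del: upt_Suc map_map)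
qed

text \<open>T_1 acts last and turns the first letter into an \<open>exch\<close>, which is the
  recursion of \<open>twist\<close>. The entering index \<open>i\<close> becomes the new first
  letter, and the emerging index \<open>k\<close> is the old last letter.\<close>

lemma wick_op_prod_letter:
  assumes "x \<in> tensor_power n"
  shows "wick_op_prod T n (x * word [k]) = (\<Sum>i\<in>UNIV. word [i] * twist T i k x)"
  using assms
proof (induction rule: tensor_power_induct)
  case (word w)
  then show ?case
  proof (induction w arbitrary: n)
    case Nil
    then show ?case
      by (simp add: wick_op_prod_def twist_one if_distrib[of "\<lambda>a. _ * a"] cong: if_cong)
  next
    case (Cons j w)
    then obtain m where m: "n = Suc m" "length w = m" by auto
    have "wick_op_prod T n (word (j # w) * word [k])
        = wick_op_at T 1 (word [j] * wick_op_prod T m (word w * word [k]))"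
      by (simp only: m word_Cons[of j w] mult.assoc wick_op_prod_Suc)
    also have "\<dots> = (\<Sum>l\<in>UNIV. \<Sum>i\<in>UNIV. word [i] * (exch T i j l * twist T l k (word w)))"
      by (simp only: Cons.IH[OF m(2)] sum_distrib_left flin_sum[OF flin_wick_op_at] wick_op_at_first)
    also have "\<dots> = (\<Sum>i\<in>UNIV. word [i] * twist T i k (word (j # w)))"
      by (subst sum.swap) (simp only: word_Cons[of j w] twist_letter_mult sum_distrib_left)
    finally show ?case .
  qed
next
  case (add p q)
  then show ?case by (simp add: distrib_right distrib_left sum.distrib)
next
  case (scale c p)
  then show ?case by (simp add: cscale_mult free_alg.scale_sum_right)
qed simp


section \<open>The braid relation\<close>

lemma wick_op_at_1_word:
  "wick_op_at T 1 (word [a, b, c])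
     = (\<Sum>x\<in>UNIV. \<Sum>y\<in>UNIV. cscale (T x a b y) (word [x, y, c]))"
  by (simp add: wick_op_at_def wick_op_def numeral_2_eq_2 sum_distrib_right cscale_mult)

lemma wick_op_at_2_word:
  "wick_op_at T 2 (word [a, b, c])
     = (\<Sum>x\<in>UNIV. \<Sum>y\<in>UNIV. cscale (T x b c y) (word [a, x, y]))"
  by (simp add: wick_op_at_def wick_op_def numeral_2_eq_2 sum_distrib_left cscale_mult)

lemma sum_if_const: "(\<Sum>x\<in>A. if P then f x else 0) = (if P then sum f A else 0)"
  by simp

text \<open>One delta per letter, so that each of the nested sums collapses separately.\<close>

lemma three_letter_delta:
  "(if [x, y, z] = [a, b, c] then (1::complex) else 0)
     = (if x = a then 1 else 0) * ((if y = b then 1 else 0) * (if z = c then 1 else 0))"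
  by simp

text \<open>Coefficients of the image through coefficients of the argument: a threefold composition
  can then be evaluated from the outside, without expanding it on words.\<close>

lemma lookup_wick_op_at_1:
  assumes "x \<in> tensor_power 3"
  shows "Poly_Mapping.lookup (wick_op_at T 1 x) [f, g, w]
    = (\<Sum>p\<in>UNIV. \<Sum>q\<in>UNIV. T f p q g * Poly_Mapping.lookup x [p, q, w])"
  using assms
proof (induction rule: tensor_power_induct)
  case (word v)
  then obtain a b c where "v = [a, b, c]"
    by (auto simp: numeral_3_eq_3 length_Suc_conv)
  then show ?case
    by (simp only: wick_op_at_1_word lookup_sum lookup_cscale lookup_single when_def three_letter_delta)
       (simp add: if_distrib[of "\<lambda>a. _ * a"] if_distrib[of "\<lambda>a. a * _"] sum_if_const cong: if_cong)
next
  case (scale c p)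
  then show ?case by (simp add: sum_distrib_left mult.left_commute)
qed (simp_all add: lookup_add distrib_left sum.distrib)

lemma lookup_wick_op_at_2:
  assumes "x \<in> tensor_power 3"
  shows "Poly_Mapping.lookup (wick_op_at T 2 x) [w, f, g]
    = (\<Sum>p\<in>UNIV. \<Sum>q\<in>UNIV. T f p q g * Poly_Mapping.lookup x [w, p, q])"
  using assms
proof (induction rule: tensor_power_induct)
  case (word v)
  then obtain a b c where "v = [a, b, c]"
    by (auto simp: numeral_3_eq_3 length_Suc_conv)
  then show ?case
    by (simp only: wick_op_at_2_word lookup_sum lookup_cscale lookup_single when_def three_letter_delta)
       (simp add: if_distrib[of "\<lambda>a. _ * a"] if_distrib[of "\<lambda>a. a * _"] sum_if_const cong: if_cong)
next
  case (scale c p)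
  then show ?case by (simp add: sum_distrib_left mult.left_commute)
qed (simp_all add: lookup_add distrib_left sum.distrib)

lemma wick_op_at_in_tensor_power_3:
  assumes "x \<in> tensor_power 3"
  shows "wick_op_at T 1 x \<in> tensor_power 3" "wick_op_at T 2 x \<in> tensor_power 3"
proof -
  have "wick_op_at T 1 (word w) \<in> tensor_power 3 \<and> wick_op_at T 2 (word w) \<in> tensor_power 3"
    if len: "length w = 3" for w
  proof -
    obtain a b c where w: "w = [a, b, c]"
      using len by (auto simp: numeral_3_eq_3 length_Suc_conv)
    show ?thesis
      unfolding w wick_op_at_1_word wick_op_at_2_word
      by (intro conjI free_alg.subspace_sum free_alg.subspace_scale subspace_tensor_power) simp_all
  qed
  with assms have "wick_op_at T 1 x \<in> tensor_power 3 \<and> wick_op_at T 2 x \<in> tensor_power 3"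
    by (induction rule: tensor_power_induct)
      (auto simp: free_alg.subspace_0 free_alg.subspace_add free_alg.subspace_scale
        subspace_tensor_power)
  then show "wick_op_at T 1 x \<in> tensor_power 3" "wick_op_at T 2 x \<in> tensor_power 3"
    by blast+
qed

text \<open>Both sides are the coefficient of e_f \<otimes> e_g \<otimes> e_w in the braid relation
  applied to e_a \<otimes> e_b \<otimes> e_c. The innermost operator fixes one letter, which removes
  one of four summation indices.\<close>

lemma braided_coeffs:
  assumes "braided T"
  shows "(\<Sum>p\<in>UNIV. \<Sum>q\<in>UNIV. \<Sum>r\<in>UNIV. T f p q g * (T q r c w * T p a b r))
       = (\<Sum>p\<in>UNIV. \<Sum>q\<in>UNIV. \<Sum>r\<in>UNIV. T g p q w * (T f a r p * T r b c q))"
proof -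
  let ?x = "word [a, b, c]"
  have x: "?x \<in> tensor_power 3" by simp
  note mem = wick_op_at_in_tensor_power_3
  have 1: "Poly_Mapping.lookup (wick_op_at T 1 ?x) [p, r, s] = (if s = c then T p a b r else 0)" for p r s
    by (simp only: wick_op_at_1_word lookup_sum lookup_cscale lookup_single when_def three_letter_delta)
       (simp add: if_distrib[of "\<lambda>a. _ * a"] if_distrib[of "\<lambda>a. a * _"] eq_commute cong: if_cong)
  have 2: "Poly_Mapping.lookup (wick_op_at T 2 ?x) [s, p, r] = (if s = a then T p b c r else 0)" for p r s
    by (simp only: wick_op_at_2_word lookup_sum lookup_cscale lookup_single when_def three_letter_delta)
       (simp add: if_distrib[of "\<lambda>a. _ * a"] if_distrib[of "\<lambda>a. a * _"] eq_commute cong: if_cong)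
  have "Poly_Mapping.lookup (wick_op_at T 1 (wick_op_at T 2 (wick_op_at T 1 ?x))) [f, g, w]
      = Poly_Mapping.lookup (wick_op_at T 2 (wick_op_at T 1 (wick_op_at T 2 ?x))) [f, g, w]"
    using assms x unfolding braided_def by simp
  then have "(\<Sum>p\<in>UNIV. \<Sum>q\<in>UNIV. T f p q g * (\<Sum>r\<in>UNIV. \<Sum>s\<in>UNIV. T q r s w * (if s = c then T p a b r else 0)))
     = (\<Sum>p\<in>UNIV. \<Sum>q\<in>UNIV. T g p q w * (\<Sum>s\<in>UNIV. \<Sum>r\<in>UNIV. T f s r p * (if s = a then T r b c q else 0)))"
    by (simp only: lookup_wick_op_at_1 lookup_wick_op_at_2 mem x 1 2)
  then show ?thesis
    by (subst (asm) (2) sum.swap)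
       (simp add: sum_distrib_left if_distrib[of "\<lambda>a. _ * a"] cong: if_cong)
qed

text \<open>Nested sums become one sum over a product type, so that a permutation of six indices is
  a single bijection.\<close>

lemma sum_UNIV_prod:
  fixes f :: "'a::finite \<Rightarrow> 'b::finite \<Rightarrow> 'c::comm_monoid_add"
  shows "(\<Sum>x\<in>UNIV. \<Sum>y\<in>UNIV. f x y) = (\<Sum>z\<in>UNIV. f (fst z) (snd z))"
  by (simp add: sum.cartesian_product split_def)

text \<open>The form of the braid relation obtained by moving an annihilator past a longer and longer tensor;
  the matrix coefficients \<^term>\<open>twist T i k\<close> of \<open>T\<^sub>1 \<cdots> T\<^sub>n\<close> commute up to \<open>T\<close>.\<close>

lemma braided_twist:
  fixes T :: "'d::finite wick_coeffs"
  assumes "braided T"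
  shows "(\<Sum>m\<in>UNIV. \<Sum>p\<in>UNIV. cscale (T i m p s) (twist T p j (twist T m k x)))
       = (\<Sum>p\<in>UNIV. \<Sum>l\<in>UNIV. cscale (T p k j l) (twist T s l (twist T i p x)))"
proof (induction x rule: free_alg_induct)
  case (word w)
  show ?case
  \<comment> \<open>\<open>i\<close> and \<open>s\<close> must vary: on the shorter word the
    relation is used for the new indices \<open>y\<close> and \<open>x\<close>, whereas
    \<open>j\<close> and \<open>k\<close> stay fixed.\<close>
  proof (induction w arbitrary: i s)
    case Nil
    show ?case
      by (simp add: twist_one if_distrib[of "twist T _ _"] if_distrib[of "cscale _"] sum_if_const cong: if_cong)
  next
    case (Cons a w)
    \<comment> \<open>The first letter \<open>a\<close> becomes \<open>r\<close> and then
      \<open>v\<close>; the annihilators that go on into \<open>w\<close> carry the indices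
      \<open>q\<close> and \<open>u\<close>.\<close>
    have twist2: "twist T p j (twist T m k (word (a # w)))
        = (\<Sum>q\<in>UNIV. \<Sum>r\<in>UNIV. \<Sum>u\<in>UNIV. \<Sum>v\<in>UNIV. cscale (T m a q r * T p r u v)
            (word [v] * twist T u j (twist T q k (word w))))" for p j m k
    proof -
      have "twist T p j (twist T m k (word (a # w)))
          = (\<Sum>q\<in>UNIV. twist T p j (exch T m a q * twist T q k (word w)))"
        by (simp only: word_Cons[of a w] twist_letter_mult flin_sum[OF flin_twist])
      also have "\<dots> = (\<Sum>q\<in>UNIV. \<Sum>r\<in>UNIV. cscale (T m a q r)
          (\<Sum>u\<in>UNIV. exch T p r u * twist T u j (twist T q k (word w))))"
        by (simp add: exch_def[of T m] sum_distrib_right flin_sum[OF flin_twist] cscale_mult_left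
            twist_letter_mult)
      also have "\<dots> = (\<Sum>q\<in>UNIV. \<Sum>r\<in>UNIV. \<Sum>u\<in>UNIV. \<Sum>v\<in>UNIV. cscale (T m a q r * T p r u v)
            (word [v] * twist T u j (twist T q k (word w))))"
        by (simp add: exch_def sum_distrib_right free_alg.scale_sum_right cscale_mult_left)
      finally show ?thesis .
    qed
    let ?Z = "\<lambda>v p m. word [v] * twist T p j (twist T m k (word w))"
    have "(\<Sum>m\<in>UNIV. \<Sum>p\<in>UNIV. cscale (T i m p s) (twist T p j (twist T m k (word (a # w)))))
        = (\<Sum>m\<in>UNIV. \<Sum>p\<in>UNIV. \<Sum>q\<in>UNIV. \<Sum>r\<in>UNIV. \<Sum>u\<in>UNIV. \<Sum>v\<in>UNIV.
            cscale (T i m p s * (T p r u v * T m a q r)) (?Z v u q))"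
      by (simp add: twist2 free_alg.scale_sum_right mult_ac)
    also have "\<dots> = (\<Sum>q\<in>UNIV. \<Sum>u\<in>UNIV. \<Sum>v\<in>UNIV. \<Sum>m\<in>UNIV. \<Sum>p\<in>UNIV. \<Sum>r\<in>UNIV.
            cscale (T i m p s * (T p r u v * T m a q r)) (?Z v u q))"
      unfolding sum_UNIV_prod
      by (rule sum.reindex_bij_witness[of _ "\<lambda>(q,u,v,m,p,r). (m,p,q,r,u,v)"
            "\<lambda>(m,p,q,r,u,v). (q,u,v,m,p,r)"]) auto
    also have "\<dots> = (\<Sum>q\<in>UNIV. \<Sum>u\<in>UNIV. \<Sum>v\<in>UNIV. cscale
            (\<Sum>m\<in>UNIV. \<Sum>p\<in>UNIV. \<Sum>r\<in>UNIV. T i m p s * (T p r u v * T m a q r)) (?Z v u q))"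
      by (simp add: free_alg.scale_sum_left)
    \<comment> \<open>The scalar is the coefficient of e_i \<otimes> e_s \<otimes> e_v in T_1 T_2
      T_1 (e_a \<otimes> e_q \<otimes> e_u), so the braid relation rewrites it.\<close>
    also have "\<dots> = (\<Sum>q\<in>UNIV. \<Sum>u\<in>UNIV. \<Sum>v\<in>UNIV. cscale
            (\<Sum>r\<in>UNIV. \<Sum>x\<in>UNIV. \<Sum>y\<in>UNIV. T s r x v * (T i a y r * T y q u x)) (?Z v u q))"
      by (simp only: braided_coeffs[OF assms])
    also have "\<dots> = (\<Sum>q\<in>UNIV. \<Sum>u\<in>UNIV. \<Sum>v\<in>UNIV. \<Sum>r\<in>UNIV. \<Sum>x\<in>UNIV. \<Sum>y\<in>UNIV.
            cscale (T s r x v * (T i a y r * T y q u x)) (?Z v u q))"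
      by (simp add: free_alg.scale_sum_left)
    also have "\<dots> = (\<Sum>y\<in>UNIV. \<Sum>r\<in>UNIV. \<Sum>x\<in>UNIV. \<Sum>v\<in>UNIV. \<Sum>q\<in>UNIV. \<Sum>u\<in>UNIV.
            cscale (T s r x v * (T i a y r * T y q u x)) (?Z v u q))"
      unfolding sum_UNIV_prod
      by (rule sum.reindex_bij_witness[of _ "\<lambda>(y,r,x,v,q,u). (q,u,v,r,x,y)"
            "\<lambda>(q,u,v,r,x,y). (y,r,x,v,q,u)"]) auto
    also have "\<dots> = (\<Sum>y\<in>UNIV. \<Sum>r\<in>UNIV. \<Sum>x\<in>UNIV. \<Sum>v\<in>UNIV. cscale (T i a y r * T s r x v) (word [v] *
            (\<Sum>m\<in>UNIV. \<Sum>p\<in>UNIV. cscale (T y m p x) (twist T p j (twist T m k (word w))))))"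
      by (simp add: free_alg.scale_sum_right sum_distrib_left mult_cscale_right mult_ac)
    also have "\<dots> = (\<Sum>y\<in>UNIV. \<Sum>r\<in>UNIV. \<Sum>x\<in>UNIV. \<Sum>v\<in>UNIV. cscale (T i a y r * T s r x v) (word [v] *
            (\<Sum>p\<in>UNIV. \<Sum>l\<in>UNIV. cscale (T p k j l) (twist T x l (twist T y p (word w))))))"
      by (simp only: Cons.IH)
    also have "\<dots> = (\<Sum>y\<in>UNIV. \<Sum>r\<in>UNIV. \<Sum>x\<in>UNIV. \<Sum>v\<in>UNIV. \<Sum>p\<in>UNIV. \<Sum>l\<in>UNIV.
            cscale (T p k j l * (T i a y r * T s r x v))
              (word [v] * twist T x l (twist T y p (word w))))"
      by (simp add: free_alg.scale_sum_right sum_distrib_left mult_cscale_right mult_ac)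
    also have "\<dots> = (\<Sum>p\<in>UNIV. \<Sum>l\<in>UNIV. \<Sum>y\<in>UNIV. \<Sum>r\<in>UNIV. \<Sum>x\<in>UNIV. \<Sum>v\<in>UNIV.
            cscale (T p k j l * (T i a y r * T s r x v))
              (word [v] * twist T x l (twist T y p (word w))))"
      unfolding sum_UNIV_prod
      by (rule sum.reindex_bij_witness[of _ "\<lambda>(p,l,y,r,x,v). (y,r,x,v,p,l)"
            "\<lambda>(y,r,x,v,p,l). (p,l,y,r,x,v)"]) auto
    also have "\<dots> = (\<Sum>p\<in>UNIV. \<Sum>l\<in>UNIV. cscale (T p k j l) (twist T s l (twist T i p (word (a # w)))))"
      by (simp add: twist2 free_alg.scale_sum_right)
    finally show ?case .
  qed
next
  case (add p q)
  then show ?case by (simp add: free_alg.scale_right_distrib sum.distrib)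
next
  case (scale c p)
  have "(\<Sum>m\<in>UNIV. \<Sum>p'\<in>UNIV. cscale (T i m p' s) (twist T p' j (twist T m k (cscale c p))))
      = cscale c (\<Sum>m\<in>UNIV. \<Sum>p'\<in>UNIV. cscale (T i m p' s) (twist T p' j (twist T m k p)))"
    by (simp add: free_alg.scale_sum_right mult.commute)
  also have "\<dots> = (\<Sum>p'\<in>UNIV. \<Sum>l\<in>UNIV. cscale (T p' k j l) (twist T s l (twist T i p' (cscale c p))))"
    by (simp add: scale free_alg.scale_sum_right mult.commute)
  finally show ?case .
qed simp


section \<open>The inductive step\<close>

text \<open>A criterion inside the tensor powers, which keeps the inductive step clear of the
  quotient \<open>W(T)\<close>.\<close>

definition wick_generating :: "'d::finite wick_coeffs \<Rightarrow> nat \<Rightarrow> 'd free_alg set \<Rightarrow> bool" where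
  "wick_generating T n I \<longleftrightarrow> free_alg.subspace I \<and> I \<subseteq> tensor_power n \<and>
     (\<forall>x\<in>I. \<forall>i. annih T i x = 0 \<and> (\<forall>k. twist T i k x \<in> I))"

lemma tensor_prod_tensor_power_1:
  assumes "free_alg.subspace I"
  shows "tensor_prod I (tensor_power 1) = free_alg.span {x * word [k] | x k. x \<in> I}" (is "?L = ?R")
proof
  have "x * y \<in> ?R" if x: "x \<in> I" and y: "y \<in> tensor_power 1" for x y
    using y
  proof (induction rule: tensor_power_induct)
    case (word w)
    then obtain k where "w = [k]" by (auto simp: length_Suc_conv)
    with x show ?case by (auto intro: free_alg.span_base)
  next
    case (scale c p)
    then show ?case by (simp only: mult_cscale_right free_alg.span_scale)
  qed (auto simp: distrib_left intro: free_alg.span_add free_alg.span_zero)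
  then show "?L \<subseteq> ?R"
    unfolding tensor_prod_def by (intro free_alg.span_minimal) auto
  show "?R \<subseteq> ?L"
    unfolding tensor_prod_def by (intro free_alg.span_mono) fastforce
qed

lemma wick_generating_step:
  fixes T :: "'d::finite wick_coeffs"
  assumes "braided T" and "wick_generating T n I"
  shows "wick_generating T (n + 1)
           ((\<lambda>x. x - wick_op_prod T n x) ` tensor_prod I (tensor_power 1))"
proof -
  define g where "g = (\<lambda>x. x - wick_op_prod T n x)"
  define S where "S = {x * word [k] | x k. x \<in> I}"
  have annih0: "annih T i x = 0" and twist: "twist T i k x \<in> I" if "x \<in> I" for i k x
    using assms(2) that unfolding wick_generating_def by auto
  have sub: "free_alg.subspace I" and deg: "I \<subseteq> tensor_power n"
    using assms(2) unfolding wick_generating_def by auto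
  have lin: "flin g"
    unfolding g_def by (rule flin_subtract[OF flin_id flin_wick_op_prod])
  have eq: "(\<lambda>x. x - wick_op_prod T n x) ` tensor_prod I (tensor_power 1) = g ` free_alg.span S"
    unfolding g_def S_def tensor_prod_tensor_power_1[OF sub] ..
  have sub': "free_alg.subspace (g ` free_alg.span S)"
    by (intro subspace_image lin free_alg.subspace_span)
  have g_gen: "g (x * word [k]) = x * word [k] - (\<Sum>m\<in>UNIV. word [m] * twist T m k x)"
    if "x \<in> I" for x k
    using that deg wick_op_prod_letter[of x n T k] by (auto simp: g_def)

  have "g x \<in> tensor_power (n + 1)" if "x \<in> free_alg.span S" for x
  proof (rule span_image_subset[OF lin subspace_tensor_power _ that])
    fix y assume "y \<in> S"
    then obtain x k where y: "y = x * word [k]" and x: "x \<in> I" unfolding S_def by auto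
    have "word [m] * twist T m k x \<in> tensor_power (n + 1)" for m
      using twist[OF x] deg by (intro mult_in_tensor_power'[of _ 1 _ n]) auto
    moreover have "x * word [k] \<in> tensor_power (n + 1)"
      using x deg by (intro mult_in_tensor_power) auto
    ultimately show "g y \<in> tensor_power (n + 1)"
      unfolding y g_gen[OF x]
      by (intro free_alg.subspace_diff free_alg.subspace_sum subspace_tensor_power)
  qed
  moreover have "annih T i (g x) = 0" if "x \<in> free_alg.span S" for i x
  proof -
    have "annih T i (g x) \<in> {0}"
    proof (rule span_image_subset[OF flin_compose[OF lin flin_annih] free_alg.subspace_single_0 _ that])
      fix y assume "y \<in> S"
      then obtain x k where y: "y = x * word [k]" and x: "x \<in> I" unfolding S_def by auto
      \<comment> \<open>Since \<open>annih\<close> kills \<open>x\<close> and every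
        \<open>twist T m k x\<close>, both parts of \<open>g y\<close> contribute
        \<open>twist T i k x\<close>: in the first the annihilator passes \<open>x\<close> and is
        absorbed by e_k, in the second it is absorbed at once by e_i.\<close>
      show "annih T i (g y) \<in> {0}"
        unfolding y g_gen[OF x]
        by (simp add: flin_sum[OF flin_annih] annih_mult[of _ _ x] annih_letter_mult annih_letter
            annih0[OF x] annih0[OF twist[OF x]] if_distrib[of "\<lambda>a. _ * a"] cong: if_cong)
    qed
    then show ?thesis by simp
  qed
  moreover have "twist T i j (g x) \<in> g ` free_alg.span S" if "x \<in> free_alg.span S" for i j x
  proof (rule span_image_subset[OF flin_compose[OF lin flin_twist] sub' _ that])
    fix y assume "y \<in> S"
    then obtain x k where y: "y = x * word [k]" and x: "x \<in> I" unfolding S_def by auto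
    \<comment> \<open>The sums are rearranged until \<open>braided_twist\<close> applies behind each
      letter e_s. Its right side again has the shape of the subtracted part of \<open>g\<close>,
      with \<open>twist T i p x\<close> in place of \<open>x\<close>.\<close>
    have "(\<Sum>m\<in>UNIV. twist T i j (word [m] * twist T m k x))
        = (\<Sum>m\<in>UNIV. \<Sum>p\<in>UNIV. \<Sum>s\<in>UNIV.
             word [s] * cscale (T i m p s) (twist T p j (twist T m k x)))"
      by (simp add: twist_letter_mult exch_def sum_distrib_right cscale_mult)
    also have "\<dots> = (\<Sum>m\<in>UNIV. \<Sum>s\<in>UNIV. \<Sum>p\<in>UNIV.
             word [s] * cscale (T i m p s) (twist T p j (twist T m k x)))"
      by (intro sum.cong refl sum.swap)
    also have "\<dots> = (\<Sum>s\<in>UNIV. \<Sum>m\<in>UNIV. \<Sum>p\<in>UNIV.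
             word [s] * cscale (T i m p s) (twist T p j (twist T m k x)))"
      by (rule sum.swap)
    also have "\<dots> = (\<Sum>s\<in>UNIV. word [s] * (\<Sum>p\<in>UNIV. \<Sum>l\<in>UNIV.
             cscale (T p k j l) (twist T s l (twist T i p x))))"
      by (simp only: braided_twist[OF assms(1)] flip: sum_distrib_left)
    also have "\<dots> = (\<Sum>s\<in>UNIV. \<Sum>p\<in>UNIV. \<Sum>l\<in>UNIV.
             cscale (T p k j l) (word [s] * twist T s l (twist T i p x)))"
      by (simp only: sum_distrib_left mult_cscale_right)
    also have "\<dots> = (\<Sum>p\<in>UNIV. \<Sum>s\<in>UNIV. \<Sum>l\<in>UNIV.
             cscale (T p k j l) (word [s] * twist T s l (twist T i p x)))"
      by (rule sum.swap)
    also have "\<dots> = (\<Sum>p\<in>UNIV. \<Sum>l\<in>UNIV. \<Sum>s\<in>UNIV.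
             cscale (T p k j l) (word [s] * twist T s l (twist T i p x)))"
      by (intro sum.cong refl sum.swap)
    finally have right: "(\<Sum>m\<in>UNIV. twist T i j (word [m] * twist T m k x))
      = (\<Sum>p\<in>UNIV. \<Sum>l\<in>UNIV. cscale (T p k j l) (\<Sum>s\<in>UNIV. word [s] * twist T s l (twist T i p x)))"
      by (simp add: free_alg.scale_sum_right)
    have "twist T i j (x * word [k])
        = (\<Sum>p\<in>UNIV. \<Sum>l\<in>UNIV. cscale (T p k j l) (twist T i p x * word [l]))"
      by (simp only: twist_mult twist_letter exch_def sum_distrib_left mult_cscale_right)
    \<comment> \<open>The same coefficients \<open>T p k j l\<close> occur for
      \<open>x * word [k]\<close>, so the two parts recombine into values of \<open>g\<close> at
      generators built from \<open>twist T i p x\<close>, which lies in \<open>I\<close>.\<close>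
    then have "twist T i j (g y) = (\<Sum>p\<in>UNIV. \<Sum>l\<in>UNIV. cscale (T p k j l) (g (twist T i p x * word [l])))"
      unfolding y g_gen[OF x] g_gen[OF twist[OF x]]
      by (simp add: flin_sum[OF flin_twist] right free_alg.scale_right_diff_distrib sum_subtractf)
    also have "\<dots> \<in> g ` free_alg.span S"
      using twist[OF x]
      by (intro free_alg.subspace_sum sub' free_alg.subspace_scale imageI free_alg.span_base)
         (auto simp: S_def)
    finally show "twist T i j (g y) \<in> g ` free_alg.span S" .
  qed
  ultimately show ?thesis
    unfolding wick_generating_def eq using sub' by auto
qed


section \<open>A representation of the Wick algebra\<close>

text \<open>A function \<open>f\<close> stands for the element \<open>f None + (\<Sum>k. f (Some k) \<otimes> a\<^sub>k\<^sup>*)\<close> of the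
  left module obtained from \<open>W(T)\<close> by killing all normally ordered words with two or more
  annihilators.\<close>

primrec letter_act :: "'d::finite wick_coeffs \<Rightarrow> 'd letter \<Rightarrow>
    ('d option \<Rightarrow> 'd free_alg) \<Rightarrow> 'd option \<Rightarrow> 'd free_alg" where
  "letter_act T (Gen i) f = (\<lambda>z. word [i] * f z)"
| "letter_act T (Adj i) f = (\<lambda>z. case z of
      None \<Rightarrow> annih T i (f None)
    | Some k \<Rightarrow> twist T i k (f None) + annih T i (f (Some k)))"

text \<open>Pointwise in \<open>z\<close>, since \<open>lin_extend\<close> takes values in a free
  algebra and not in functions.\<close>

definition act :: "'d::finite wick_coeffs \<Rightarrow> 'd letter free_alg \<Rightarrow>
    ('d option \<Rightarrow> 'd free_alg) \<Rightarrow> 'd option \<Rightarrow> 'd free_alg" where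
  "act T p f z = lin_extend (\<lambda>w. foldr (letter_act T) w f z) p"

lemma act_linear [simp]:
  "act T (p + q) f z = act T p f z + act T q f z"
  "act T (p - q) f z = act T p f z - act T q f z"
  "act T (cscale c p) f z = cscale c (act T p f z)"
  "act T 0 f z = 0"
  by (simp_all add: act_def)

lemma act_sum: "act T (\<Sum>x\<in>A. p x) f z = (\<Sum>x\<in>A. act T (p x) f z)"
  by (simp add: act_def lin_extend_sum)

lemma act_word: "act T (word w) f = foldr (letter_act T) w f"
  by (simp add: act_def fun_eq_iff)

lemma act_one [simp]: "act T 1 f = f"
  using act_word[of T "[]" f] by simp

lemma letter_act_linear:
  "letter_act T a (\<lambda>z. f z + g z) = (\<lambda>z. letter_act T a f z + letter_act T a g z)"
  "letter_act T a (\<lambda>z. cscale c (f z)) = (\<lambda>z. cscale c (letter_act T a f z))"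
  "letter_act T a (\<lambda>z. 0) = (\<lambda>z. 0)"
  by (cases a; auto simp: fun_eq_iff distrib_left cscale_mult free_alg.scale_right_distrib
      split: option.split)+

lemma foldr_letter_act_linear:
  "foldr (letter_act T) w (\<lambda>z. f z + g z)
     = (\<lambda>z. foldr (letter_act T) w f z + foldr (letter_act T) w g z)"
  "foldr (letter_act T) w (\<lambda>z. cscale c (f z)) = (\<lambda>z. cscale c (foldr (letter_act T) w f z))"
  "foldr (letter_act T) w (\<lambda>z. 0) = (\<lambda>z. 0)"
  by (induction w) (simp_all add: letter_act_linear)

lemma act_word_mult: "act T (word w * q) f = foldr (letter_act T) w (act T q f)"
proof (induction q rule: free_alg_induct)
  case (word v)
  then show ?case by (simp add: act_word)
next
  case zero
  then show ?case
    using foldr_letter_act_linear(3)[of T w] by (simp add: fun_eq_iff act_def[abs_def])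
next
  case (add p q)
  then show ?case
    using foldr_letter_act_linear(1)[of T w "act T p f" "act T q f"]
    by (simp add: fun_eq_iff distrib_left act_def[abs_def])
next
  case (scale c p)
  then show ?case
    using foldr_letter_act_linear(2)[of T w c "act T p f"]
    by (simp add: fun_eq_iff mult_cscale_right act_def[abs_def])
qed

lemma act_mult: "act T (p * q) f = act T p (act T q f)"
proof (induction p rule: free_alg_induct)
  case (word w)
  show ?case by (simp add: act_word_mult act_word)
qed (simp_all add: fun_eq_iff distrib_right cscale_mult)

text \<open>The letter recursions of \<open>annih\<close> and \<open>twist\<close> are the Wick
  relation read in the components \<open>None\<close> and \<open>Some k\<close>.\<close>

lemma act_wick_relation: "act T (wick_relation T i j) f z = 0"
proof -
  have "act T (wick_relation T i j) f z = letter_act T (Adj i) (letter_act T (Gen j) f) z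
      - ((if i = j then f z else 0)
          + (\<Sum>k\<in>UNIV. exch T i j k * letter_act T (Adj k) f z))"
    by (simp add: wick_relation_def act_sum act_word exch_def sum_distrib_right cscale_mult_left)
  also have "\<dots> = 0"
    by (cases z) (simp_all add: annih_letter_mult twist_letter_mult distrib_left sum.distrib)
  finally show ?thesis .
qed

definition embed_gen :: "'d free_alg \<Rightarrow> 'd letter free_alg" where
  "embed_gen = lin_extend (\<lambda>w. word (map Gen w))"

lemma flin_embed_gen: "flin embed_gen"
  unfolding embed_gen_def by (rule flin_lin_extend)

lemma embed_gen_linear [simp]:
  "embed_gen (p + q) = embed_gen p + embed_gen q"
  "embed_gen (cscale c p) = cscale c (embed_gen p)"
  "embed_gen 0 = 0"
  by (simp_all add: embed_gen_def)

lemma embed_gen_word [simp]: "embed_gen (word w) = word (map Gen w)"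
  by (simp add: embed_gen_def)

lemma embed_gen_one [simp]: "embed_gen 1 = 1"
  using embed_gen_word[of "[]"] by simp

lemma embed_gen_mult: "embed_gen (p * q) = embed_gen p * embed_gen q"
proof (induction p rule: free_alg_induct)
  case (word w)
  show ?case
    by (induction q rule: free_alg_induct) (simp_all add: distrib_left cscale_mult)
qed (simp_all add: distrib_right cscale_mult)

lemma act_embed_gen: "act T (embed_gen x) f z = x * f z"
proof (induction x rule: free_alg_induct)
  case (word w)
  have "foldr (letter_act T) (map Gen w) f z = word w * f z"
    by (induction w) (simp_all flip: mult.assoc)
  then show ?case by (simp add: act_word)
qed (simp_all add: distrib_right cscale_mult)


section \<open>The ideal of relations\<close>

lemma free_star_eq_sum:
  assumes "finite A" "Poly_Mapping.keys p \<subseteq> A"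
  shows "free_star p
    = (\<Sum>w\<in>A. cscale (cnj (Poly_Mapping.lookup p w)) (word (rev (map letter_adj w))))"
  unfolding free_star_def using assms
  by (intro sum.mono_neutral_left) (auto simp: in_keys_iff)

lemma free_star_add [simp]: "free_star (p + q) = free_star p + free_star q"
  using Poly_Mapping.keys_add[of p q]
  by (simp add: free_star_eq_sum[of "Poly_Mapping.keys p \<union> Poly_Mapping.keys q"] lookup_add
      free_alg.scale_left_distrib sum.distrib)

lemma free_star_scale [simp]: "free_star (cscale c p) = cscale (cnj c) (free_star p)"
proof -
  have "Poly_Mapping.keys (cscale c p) \<subseteq> Poly_Mapping.keys p"
    by (auto simp: in_keys_iff)
  then show ?thesis
    by (simp add: free_star_eq_sum[of "Poly_Mapping.keys p"] free_alg.scale_sum_right)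
qed

lemma free_star_zero [simp]: "free_star 0 = 0"
  by (simp add: free_star_def)

lemma free_star_word [simp]: "free_star (word w) = word (rev (map letter_adj w))"
  by (simp add: free_star_def)

lemma free_star_one [simp]: "free_star 1 = 1"
  using free_star_word[of "[]"] by simp

lemma free_star_diff [simp]: "free_star (p - q) = free_star p - free_star q"
  using free_star_add[of "p - q" q] by (simp add: algebra_simps)

lemma free_star_sum: "free_star (\<Sum>x\<in>A. p x) = (\<Sum>x\<in>A. free_star (p x))"
  by (induction A rule: infinite_finite_induct) simp_all

lemma free_star_mult: "free_star (p * q) = free_star q * free_star p"
proof (induction p rule: free_alg_induct)
  case (word w)
  show ?case
    by (induction q rule: free_alg_induct) (simp_all add: distrib_left distrib_right cscale_mult)
qed (simp_all add: distrib_left distrib_right cscale_mult)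

lemma free_star_free_star [simp]: "free_star (free_star p) = p"
proof (induction p rule: free_alg_induct)
  case (word w)
  have "letter_adj (letter_adj a) = a" for a :: "'a letter"
    by (cases a) simp_all
  then show ?case by (simp add: rev_map[symmetric] o_def)
qed simp_all

text \<open>Self-adjointness of \<open>T\<close> enters here: the involution exchanges
  \<open>i\<close> with \<open>j\<close> and conjugates the coefficients, and swapping both index
  pairs undoes the conjugation.\<close>

lemma free_star_wick_relation:
  assumes "hermitian_coeffs T"
  shows "free_star (wick_relation T i j) = wick_relation T j i"
proof -
  have cnj: "cnj (T i j k l) = T j i l k" for k l
    using assms unfolding hermitian_coeffs_def by metis
  have "free_star (wick_relation T i j) = word [Adj j] * word [Gen i] - ((if i = j then 1 else 0)
      + (\<Sum>k\<in>UNIV. \<Sum>l\<in>UNIV. cscale (cnj (T i j k l)) (word [Gen k] * word [Adj l])))"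
    unfolding wick_relation_def by (simp add: free_star_sum)
  also have "(\<Sum>k\<in>UNIV. \<Sum>l\<in>UNIV. cscale (cnj (T i j k l)) (word [Gen k] * word [Adj l]))
      = (\<Sum>l\<in>UNIV. \<Sum>k\<in>UNIV. cscale (T j i l k) (word [Gen k] * word [Adj l]))"
    by (subst sum.swap) (simp only: cnj)
  finally show ?thesis
    unfolding wick_relation_def by (simp only: eq_commute[of i j])
qed

section \<open>The free algebra as a ring, and the relation ideal in it\<close>

lemma free_ring_simps [simp]:
  "carrier (free_ring :: 'x free_alg ring) = UNIV"
  "monoid.mult (free_ring :: 'x free_alg ring) = (*)"
  "one (free_ring :: 'x free_alg ring) = 1"
  "zero (free_ring :: 'x free_alg ring) = 0"
  "add (free_ring :: 'x free_alg ring) = (+)"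
  by (simp_all add: ring_of_type_algebra_def fun_eq_iff)

lemma ring_free_ring: "ring (free_ring :: 'x free_alg ring)"
proof -
  have "\<exists>y. x + y = 0" for x :: "'x free_alg"
    using add.right_inverse by blast
  then show ?thesis
    by unfold_locales (auto simp: algebra_simps Units_def)
qed

interpretation free_ring: ring "free_ring :: 'x free_alg ring"
  by (rule ring_free_ring)

lemma free_ring_a_inv [simp]: "\<ominus>\<^bsub>free_ring\<^esub> x = - (x :: 'x free_alg)"
  by (rule free_ring.minus_equality) simp_all

lemma ideal_free_ringI:
  fixes J :: "'x free_alg set"
  assumes "0 \<in> J" "\<And>p q. p \<in> J \<Longrightarrow> q \<in> J \<Longrightarrow> p + q \<in> J"
    and "\<And>p q. p \<in> J \<Longrightarrow> q * p \<in> J" "\<And>p q. p \<in> J \<Longrightarrow> p * q \<in> J"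
  shows "ideal J free_ring"
proof (rule idealI[OF ring_free_ring])
  have "- p \<in> J" if "p \<in> J" for p
    using assms(3)[OF that, of "- 1"] by simp
  then show "subgroup J (add_monoid free_ring)"
    using assms(1,2) by (intro free_ring.add.subgroupI) auto
qed (use assms in auto)

context
  fixes T :: "'d::finite wick_coeffs"
begin

lemma ideal_wick_relation_ideal: "ideal (wick_relation_ideal T) free_ring"
proof -
  \<comment> \<open>The whole algebra belongs to the family, so the intersection is over a nonempty
    family of ideals.\<close>
  have "ideal UNIV (free_ring :: 'd letter free_alg ring)"
    by (rule ideal_free_ringI) auto
  then show ?thesis
    unfolding wick_relation_ideal_def by (intro free_ring.i_Intersect) auto
qed

interpretation K: ideal "wick_relation_ideal T" free_ring
  by (rule ideal_wick_relation_ideal)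

lemma wick_relation_ideal_closed:
  "0 \<in> wick_relation_ideal T"
  "p \<in> wick_relation_ideal T \<Longrightarrow> q \<in> wick_relation_ideal T \<Longrightarrow> p + q \<in> wick_relation_ideal T"
  "p \<in> wick_relation_ideal T \<Longrightarrow> q \<in> wick_relation_ideal T \<Longrightarrow> p - q \<in> wick_relation_ideal T"
  "p \<in> wick_relation_ideal T \<Longrightarrow> r * p \<in> wick_relation_ideal T"
  "p \<in> wick_relation_ideal T \<Longrightarrow> p * r \<in> wick_relation_ideal T"
  "p \<in> wick_relation_ideal T \<Longrightarrow> - p \<in> wick_relation_ideal T"
  "p \<in> wick_relation_ideal T \<Longrightarrow> cscale c p \<in> wick_relation_ideal T"
proof -
  show *: "p \<in> wick_relation_ideal T \<Longrightarrow> - p \<in> wick_relation_ideal T" for p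
    using K.a_inv_closed by simp
  show add: "p \<in> wick_relation_ideal T \<Longrightarrow> q \<in> wick_relation_ideal T \<Longrightarrow> p + q \<in> wick_relation_ideal T" for p q
    using K.a_closed by simp
  show "p \<in> wick_relation_ideal T \<Longrightarrow> q \<in> wick_relation_ideal T \<Longrightarrow> p - q \<in> wick_relation_ideal T"
    using add[OF _ *] by fastforce
  show mult: "p \<in> wick_relation_ideal T \<Longrightarrow> r * p \<in> wick_relation_ideal T" for r
    using K.I_l_closed by simp
  show "p \<in> wick_relation_ideal T \<Longrightarrow> p * r \<in> wick_relation_ideal T"
    using K.I_r_closed by simp
  show "p \<in> wick_relation_ideal T \<Longrightarrow> cscale c p \<in> wick_relation_ideal T"
    using mult by (simp add: cscale_conv_mult)
  show "0 \<in> wick_relation_ideal T"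
    using K.zero_closed by simp
qed

lemma wick_relation_in_ideal: "wick_relation T i j \<in> wick_relation_ideal T"
  unfolding wick_relation_ideal_def by auto

text \<open>This makes the action well defined on \<open>W(T)\<close>: congruent representatives act
  alike.\<close>

lemma act_wick_relation_ideal:
  assumes "hermitian_coeffs T" and "p \<in> wick_relation_ideal T"
  shows "act T p f z = 0"
proof -
  \<comment> \<open>The relation ideal is least among the star-closed ideals, so the ideal compared
    with it must be star-closed too. For the annihilator of the module this is not evident, hence
    the condition on \<open>free_star p\<close>.\<close>
  define J where "J = {p. \<forall>f z. act T p f z = 0 \<and> act T (free_star p) f z = 0}"
  have zero: "act T p (\<lambda>z. 0) z = 0" for p z
    by (induction p rule: free_alg_induct) (simp_all add: act_word foldr_letter_act_linear)
  have left: "act T (q * p) f z = 0" if "\<And>f z. act T p f z = 0" for p q f z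
  proof -
    have "act T p f = (\<lambda>z. 0)" using that by (simp add: fun_eq_iff)
    then show ?thesis by (simp only: act_mult zero)
  qed
  have right: "act T (p * q) f z = 0" if "\<And>f z. act T p f z = 0" for p q f z
    using that by (simp only: act_mult)
  have "ideal J free_ring"
    by (rule ideal_free_ringI) (auto simp: J_def free_star_mult intro: left right)
  moreover have "free_star ` J \<subseteq> J"
    by (auto simp: J_def)
  moreover have "wick_relation T i j \<in> J" for i j
    by (simp add: J_def free_star_wick_relation[OF assms(1)] act_wick_relation)
  ultimately have "p \<in> J"
    using assms(2) unfolding wick_relation_ideal_def by blast
  then show ?thesis by (simp add: J_def)
qed

end


section \<open>The quotient algebra\<close>

context
  fixes T :: "'d::finite wick_coeffs"
begin

interpretation K: ideal "wick_relation_ideal T" free_ring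
  by (rule ideal_wick_relation_ideal)

lemma wick_class_eq: "wick_class T p = (\<lambda>h. h + p) ` wick_relation_ideal T"
  by (auto simp: wick_class_def a_r_coset_def')

lemma wick_class_eq_iff: "wick_class T p = wick_class T q \<longleftrightarrow> p - q \<in> wick_relation_ideal T"
proof
  assume "wick_class T p = wick_class T q"
  moreover have "p \<in> wick_class T p"
    using wick_relation_ideal_closed(1) by (force simp: wick_class_eq)
  ultimately show "p - q \<in> wick_relation_ideal T"
    by (auto simp: wick_class_eq)
next
  assume *: "p - q \<in> wick_relation_ideal T"
  show "wick_class T p = wick_class T q"
    unfolding wick_class_eq
  proof (intro subset_antisym image_subsetI)
    fix h assume h: "h \<in> wick_relation_ideal T"
    show "h + p \<in> (\<lambda>h. h + q) ` wick_relation_ideal T"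
      using wick_relation_ideal_closed(2)[OF h *] by (intro image_eqI[of _ _ "h + (p - q)"]) simp_all
    show "h + q \<in> (\<lambda>h. h + p) ` wick_relation_ideal T"
      using wick_relation_ideal_closed(3)[OF h *] by (intro image_eqI[of _ _ "h - (p - q)"]) simp_all
  qed
qed

lemma wick_algebra_simps [simp]:
  "carrier (wick_algebra T) = range (wick_class T)"
  "wick_class T p \<otimes>\<^bsub>wick_algebra T\<^esub> wick_class T q = wick_class T (p * q)"
  "wick_class T p \<oplus>\<^bsub>wick_algebra T\<^esub> wick_class T q = wick_class T (p + q)"
  "\<one>\<^bsub>wick_algebra T\<^esub> = wick_class T 1"
  "\<zero>\<^bsub>wick_algebra T\<^esub> = wick_class T 0"
  "c \<odot>\<^bsub>wick_algebra T\<^esub> wick_class T p = wick_class T (cscale c p)"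
proof -
  note defs = wick_algebra_def ring.defs module.defs FactRing_def
  show "carrier (wick_algebra T) = range (wick_class T)"
    by (auto simp: defs A_RCOSETS_def' wick_class_def)
  show "wick_class T p \<otimes>\<^bsub>wick_algebra T\<^esub> wick_class T q = wick_class T (p * q)"
    using K.rcoset_mult_add[of p q] by (simp add: defs wick_class_def)
  show "wick_class T p \<oplus>\<^bsub>wick_algebra T\<^esub> wick_class T q = wick_class T (p + q)"
    using K.a_rcos_sum[of p q] by (simp add: defs wick_class_def)
  show "\<one>\<^bsub>wick_algebra T\<^esub> = wick_class T 1"
    by (simp add: defs wick_class_def)
  show "\<zero>\<^bsub>wick_algebra T\<^esub> = wick_class T 0"
    by (simp add: defs wick_class_eq)
  \<comment> \<open>Scalar multiplication of a class is a union over its representatives; all of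
    them give the same class, so the union is constant.\<close>
  have *: "wick_class T (cscale c q) = wick_class T (cscale c p)" if "q \<in> wick_class T p" for q
    using that wick_relation_ideal_closed(7)
    by (auto simp: wick_class_eq_iff wick_class_eq[of p] simp flip: free_alg.scale_right_diff_distrib)
  have "p \<in> wick_class T p"
    using wick_relation_ideal_closed(1) by (force simp: wick_class_eq)
  then have "(\<Union>q\<in>wick_class T p. wick_class T (cscale c q)) = wick_class T (cscale c p)"
    by (rule UN_constant_eq) (use * in blast)
  then show "c \<odot>\<^bsub>wick_algebra T\<^esub> wick_class T p = wick_class T (cscale c p)"
    by (simp add: defs)
qed

lemma ring_wick_algebra: "ring (wick_algebra T)"
proof (intro ringI abelian_groupI monoidI)
  fix x assume "x \<in> carrier (wick_algebra T)"
  then obtain p where "x = wick_class T p" by auto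
  then show "\<exists>y\<in>carrier (wick_algebra T). y \<oplus>\<^bsub>wick_algebra T\<^esub> x = \<zero>\<^bsub>wick_algebra T\<^esub>"
    by (intro bexI[of _ "wick_class T (- p)"]) auto
qed (auto simp: algebra_simps)

interpretation W: ring "wick_algebra T"
  by (rule ring_wick_algebra)

lemma wick_algebra_a_inv [simp]: "\<ominus>\<^bsub>wick_algebra T\<^esub> wick_class T p = wick_class T (- p)"
  by (rule W.minus_equality) auto

section \<open>Subspaces of the quotient through representatives\<close>

lemma subgroup_image:
  assumes "0 \<in> P" "\<And>p q. p \<in> P \<Longrightarrow> q \<in> P \<Longrightarrow> p + q \<in> P" "\<And>p. p \<in> P \<Longrightarrow> - p \<in> P"
  shows "subgroup (wick_class T ` P) (add_monoid (wick_algebra T))"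
proof (rule W.add.subgroupI)
  fix a assume "a \<in> wick_class T ` P"
  then obtain p where p: "a = wick_class T p" "p \<in> P" by auto
  show "\<ominus>\<^bsub>wick_algebra T\<^esub> a \<in> wick_class T ` P"
    using p(2) assms(3) by (auto simp: p(1))
  fix b assume "b \<in> wick_class T ` P"
  then obtain q where q: "b = wick_class T q" "q \<in> P" by auto
  show "a \<oplus>\<^bsub>wick_algebra T\<^esub> b \<in> wick_class T ` P"
    using p(2) q(2) assms(2) by (auto simp: p(1) q(1))
qed (use assms(1) in auto)

lemma submodule_image:
  assumes "free_alg.subspace P"
  shows "submodule (wick_class T ` P) complex_ring (wick_algebra T)"
proof (intro submodule.intro submodule_axioms.intro)
  show "subgroup (wick_class T ` P) (add_monoid (wick_algebra T))"
    using assms by (intro subgroup_image)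
      (auto simp: free_alg.subspace_0 free_alg.subspace_add free_alg.subspace_neg)
  show "c \<odot>\<^bsub>wick_algebra T\<^esub> x \<in> wick_class T ` P" if "x \<in> wick_class T ` P" for c x
    using that assms by (auto simp: free_alg.subspace_scale)
qed

text \<open>Together with \<open>submodule_image\<close> it turns minimality arguments in the
  quotient into span arguments in the free algebra.\<close>

lemma subspace_vimage:
  assumes "submodule V complex_ring (wick_algebra T)"
  shows "free_alg.subspace {p. wick_class T p \<in> V}" "V \<subseteq> range (wick_class T)"
proof -
  interpret V: submodule V complex_ring "wick_algebra T" by fact
  show "V \<subseteq> range (wick_class T)"
    using V.subset by simp
  show "free_alg.subspace {p. wick_class T p \<in> V}"
  proof (rule free_alg.subspaceI)
    show "0 \<in> {p. wick_class T p \<in> V}"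
      using V.one_closed by simp
    show "x + y \<in> {p. wick_class T p \<in> V}"
      if "x \<in> {p. wick_class T p \<in> V}" "y \<in> {p. wick_class T p \<in> V}" for x y
      using V.m_closed[of "wick_class T x" "wick_class T y"] that by simp
    show "cscale c x \<in> {p. wick_class T p \<in> V}" if "x \<in> {p. wick_class T p \<in> V}" for c x
      using V.smult_closed[of c "wick_class T x"] that by (simp add: ring_of_type_algebra_def)
  qed
qed

text \<open>\<open>U\<close> and \<open>V\<close> are arbitrary sets of representatives and need not
  be unions of cosets.\<close>

lemma tensor_in_image:
  "tensor_in (wick_algebra T) (wick_class T ` U) (wick_class T ` V)
     = wick_class T ` free_alg.span {u * v | u v. u \<in> U \<and> v \<in> V}" (is "_ = wick_class T ` free_alg.span ?S")
proof -
  have eq: "{u \<otimes>\<^bsub>wick_algebra T\<^esub> v | u v. u \<in> wick_class T ` U \<and> v \<in> wick_class T ` V} = wick_class T ` ?S"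
  proof (intro subset_antisym subsetI)
    fix x assume "x \<in> wick_class T ` ?S"
    then obtain u v where "x = wick_class T (u * v)" "u \<in> U" "v \<in> V" by auto
    then show "x \<in> {u \<otimes>\<^bsub>wick_algebra T\<^esub> v | u v. u \<in> wick_class T ` U \<and> v \<in> wick_class T ` V}"
      by (intro CollectI exI[of _ "wick_class T u"] exI[of _ "wick_class T v"]) simp
  next
    fix x assume "x \<in> {u \<otimes>\<^bsub>wick_algebra T\<^esub> v | u v. u \<in> wick_class T ` U \<and> v \<in> wick_class T ` V}"
    then obtain u v where "x = wick_class T (u * v)" "u \<in> U" "v \<in> V" by auto
    then show "x \<in> wick_class T ` ?S" by blast
  qed
  show ?thesis
    unfolding tensor_in_def lin_span_def eq
  proof (intro subset_antisym Inter_lower Inter_greatest)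
    show "wick_class T ` free_alg.span ?S
        \<in> {V. submodule V complex_ring (wick_algebra T) \<and> wick_class T ` ?S \<subseteq> V}"
      using submodule_image[OF free_alg.subspace_span] by (auto intro: free_alg.span_base)
    fix M assume "M \<in> {V. submodule V complex_ring (wick_algebra T) \<and> wick_class T ` ?S \<subseteq> V}"
    then have M: "submodule M complex_ring (wick_algebra T)" "wick_class T ` ?S \<subseteq> M" by auto
    from M(2) have "free_alg.span ?S \<subseteq> {p. wick_class T p \<in> M}"
      by (intro free_alg.span_minimal subspace_vimage(1)[OF M(1)]) auto
    then show "wick_class T ` free_alg.span ?S \<subseteq> M" by auto
  qed
qed

lemma generated_subalgebra_minimal:
  assumes "free_alg.subspace P" "1 \<in> P" "\<And>p q. p \<in> P \<Longrightarrow> q \<in> P \<Longrightarrow> p * q \<in> P" "S \<subseteq> P"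
  shows "generated_subalgebra (wick_algebra T) (wick_class T ` S) \<subseteq> wick_class T ` P"
proof -
  have "subring (wick_class T ` P) (wick_algebra T)"
    using assms by (intro W.subringI)
      (auto simp: free_alg.subspace_add free_alg.subspace_neg)
  then show ?thesis
    unfolding generated_subalgebra_def
    using submodule_image[OF assms(1)] assms(4) by (intro Inter_lower) auto
qed

text \<open>Working with the full preimage \<open>D\<close> and its closure properties replaces an
  explicit description of the elements of the dual tensor algebra.\<close>

lemma generated_subalgebra_closed:
  fixes S :: "'d letter free_alg set"
  defines "D \<equiv> {p. wick_class T p \<in> generated_subalgebra (wick_algebra T) (wick_class T ` S)}"
  shows "generated_subalgebra (wick_algebra T) (wick_class T ` S) = wick_class T ` D"
    and "free_alg.subspace D" and "1 \<in> D" and "\<And>p q. p \<in> D \<Longrightarrow> q \<in> D \<Longrightarrow> p * q \<in> D" and "S \<subseteq> D"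
proof -
  have "generated_subalgebra (wick_algebra T) (wick_class T ` S) \<subseteq> range (wick_class T)"
    by (rule generated_subalgebra_minimal) auto
  then show "generated_subalgebra (wick_algebra T) (wick_class T ` S) = wick_class T ` D"
    unfolding D_def by auto
  define A where "A = {A. subring A (wick_algebra T) \<and> submodule A complex_ring (wick_algebra T)
    \<and> wick_class T ` S \<subseteq> A}"
  have D: "D = (\<Inter>B\<in>A. {p. wick_class T p \<in> B})"
    unfolding D_def A_def generated_subalgebra_def by auto
  show "free_alg.subspace D"
    unfolding D by (intro free_alg.subspace_Inter) (auto simp: A_def subspace_vimage(1))
  have "1 \<in> {p. wick_class T p \<in> B}" if "B \<in> A" for B
    using subringE(3)[of B "wick_algebra T"] that by (auto simp: A_def)
  then show "1 \<in> D" unfolding D by auto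
  have "p * q \<in> {p. wick_class T p \<in> B}" if "B \<in> A" "wick_class T p \<in> B" "wick_class T q \<in> B" for B p q
    using subringE(6)[of B "wick_algebra T" "wick_class T p" "wick_class T q"] that by (auto simp: A_def)
  then show "p * q \<in> D" if "p \<in> D" "q \<in> D" for p q
    using that unfolding D by auto
  show "S \<subseteq> D" unfolding D A_def by auto
qed

section \<open>The tensor algebra inside \<open>W(T)\<close>\<close>

lemma subspace_range_embed_gen: "free_alg.subspace (range embed_gen)"
  by (intro subspace_image flin_embed_gen) simp

lemma tensor_alg_eq: "tensor_alg T = wick_class T ` range embed_gen"
proof -
  define S :: "'d letter free_alg set" where "S = {word [Gen i] | i. True}"
  have eq: "{wick_class T (word [Gen i]) | i. True} = wick_class T ` S"
    unfolding S_def by auto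
  note D = generated_subalgebra_closed[where S = S]
  show ?thesis
    unfolding tensor_alg_def eq
  proof
    show "generated_subalgebra (wick_algebra T) (wick_class T ` S) \<subseteq> wick_class T ` range embed_gen"
    proof (rule generated_subalgebra_minimal[OF subspace_range_embed_gen])
      show "1 \<in> range embed_gen"
        using embed_gen_one by (metis rangeI)
      show "p * q \<in> range embed_gen" if "p \<in> range embed_gen" "q \<in> range embed_gen"
        for p q :: "'d letter free_alg"
        using that by (auto simp flip: embed_gen_mult)
      have "word [Gen i] \<in> range embed_gen" for i :: 'd
        using embed_gen_word[of "[i]"] by (metis list.map rangeI)
      then show "S \<subseteq> range embed_gen"
        unfolding S_def by auto
    qed
    have "wick_class T (embed_gen x) \<in> generated_subalgebra (wick_algebra T) (wick_class T ` S)" for x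
    proof (induction x rule: free_alg_induct)
      case (word w)
      show ?case
      proof (induction w)
        case Nil
        then show ?case using D(3) by simp
      next
        case (Cons i w)
        have "word [Gen i] \<in> S" by (auto simp: S_def)
        with D(4)[of "word [Gen i]" "word (map Gen w)"] D(5) Cons show ?case
          by auto
      qed
    qed (use D(2) in \<open>auto simp: free_alg.subspace_def\<close>)
    then show "wick_class T ` range embed_gen
        \<subseteq> generated_subalgebra (wick_algebra T) (wick_class T ` S)"
      by auto
  qed
qed

lemma ring_tensor_alg_ring: "ring (tensor_alg_ring T)"
proof (rule W.subring_is_ring)
  show "subring (tensor_alg T) (wick_algebra T)"
    unfolding tensor_alg_def generated_subalgebra_def
    by (rule W.subring_Inter) (use W.carrier_is_subring submodule_image[OF free_alg.subspace_UNIV] in auto)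
qed

lemma tensor_alg_ring_simps [simp]:
  "carrier (tensor_alg_ring T) = wick_class T ` range embed_gen"
  "monoid.mult (tensor_alg_ring T) = monoid.mult (wick_algebra T)"
  "add (tensor_alg_ring T) = add (wick_algebra T)"
  "zero (tensor_alg_ring T) = zero (wick_algebra T)"
  by (simp_all add: tensor_alg_eq)

lemma tensor_alg_ring_a_inv:
  "\<ominus>\<^bsub>tensor_alg_ring T\<^esub> wick_class T (embed_gen x) = wick_class T (embed_gen (- x))"
proof (rule abelian_group.minus_equality)
  show "abelian_group (tensor_alg_ring T)"
    using ring_tensor_alg_ring by (rule ring.is_abelian_group)
qed (auto simp flip: embed_gen_linear)

lemma ideal_tensor_alg_ringI:
  assumes "0 \<in> J" "\<And>x y. x \<in> J \<Longrightarrow> y \<in> J \<Longrightarrow> x + y \<in> J"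
    and l: "\<And>x y. x \<in> J \<Longrightarrow> y * x \<in> J" and r: "\<And>x y. x \<in> J \<Longrightarrow> x * y \<in> J"
  shows "ideal (wick_class T ` embed_gen ` J) (tensor_alg_ring T)"
proof (rule idealI[OF ring_tensor_alg_ring])
  have "abelian_group (tensor_alg_ring T)"
    using ring_tensor_alg_ring by (rule ring.is_abelian_group)
  then interpret A: abelian_group "tensor_alg_ring T" .
  have neg: "- x \<in> J" if "x \<in> J" for x
    using l[OF that, of "- 1"] by simp
  show "subgroup (wick_class T ` embed_gen ` J) (add_monoid (tensor_alg_ring T))"
  proof (rule A.add.subgroupI)
    fix a assume "a \<in> wick_class T ` embed_gen ` J"
    then obtain p where p: "a = wick_class T (embed_gen p)" "p \<in> J" by auto
    show "\<ominus>\<^bsub>tensor_alg_ring T\<^esub> a \<in> wick_class T ` embed_gen ` J"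
      using p(2) neg by (auto simp: p(1) tensor_alg_ring_a_inv)
    fix b assume "b \<in> wick_class T ` embed_gen ` J"
    then obtain q where q: "b = wick_class T (embed_gen q)" "q \<in> J" by auto
    show "a \<oplus>\<^bsub>tensor_alg_ring T\<^esub> b \<in> wick_class T ` embed_gen ` J"
      using assms(2)[OF p(2) q(2)] by (auto simp: p(1) q(1) simp flip: embed_gen_linear)
  qed (use assms(1) in auto)
next
  fix a x assume "a \<in> wick_class T ` embed_gen ` J" "x \<in> carrier (tensor_alg_ring T)"
  then obtain p y where "a = wick_class T (embed_gen p)" "p \<in> J" "x = wick_class T (embed_gen y)"
    by auto
  then show "x \<otimes>\<^bsub>tensor_alg_ring T\<^esub> a \<in> wick_class T ` embed_gen ` J"
    and "a \<otimes>\<^bsub>tensor_alg_ring T\<^esub> x \<in> wick_class T ` embed_gen ` J"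
    using l r by (auto simp flip: embed_gen_mult)
qed

end

section \<open>Two-sided ideals of the tensor algebra\<close>

text \<open>Words suffice as outer factors, and they keep the generators homogeneous when
  \<open>I\<close> is, which the degree argument uses.\<close>

definition two_sided :: "'d free_alg set \<Rightarrow> 'd free_alg set" where
  "two_sided I = free_alg.span {word u * x * word v | u x v. x \<in> I}"

lemma subspace_two_sided: "free_alg.subspace (two_sided I)"
  unfolding two_sided_def by (rule free_alg.subspace_span)

lemma subset_two_sided: "I \<subseteq> two_sided I"
proof
  fix x assume "x \<in> I"
  then have "word [] * x * word [] \<in> two_sided I"
    unfolding two_sided_def by (intro free_alg.span_base) blast
  then show "x \<in> two_sided I" by simp
qed

lemma mult_two_sided:
  assumes "x \<in> two_sided I"
  shows "p * x \<in> two_sided I" "x * p \<in> two_sided I"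
proof -
  have "word w * x \<in> two_sided I" for w
  proof (rule span_image_subset[OF flin_mult_left subspace_two_sided _ assms[unfolded two_sided_def]])
    fix y assume "y \<in> {word u * x * word v |u x v. x \<in> I}"
    then obtain u x v where "y = word u * x * word v" "x \<in> I" by auto
    then have "word w * y = word (w @ u) * x * word v" "x \<in> I"
      by (simp_all flip: mult.assoc)
    then show "word w * y \<in> two_sided I"
      unfolding two_sided_def by (intro free_alg.span_base) blast
  qed
  then show "p * x \<in> two_sided I"
    by (induction p rule: free_alg_induct)
       (auto simp: distrib_right cscale_mult subspace_two_sided free_alg.subspace_0
         free_alg.subspace_add free_alg.subspace_scale)
  have "x * word w \<in> two_sided I" for w
  proof (rule span_image_subset[OF flin_mult_right subspace_two_sided _ assms[unfolded two_sided_def]])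
    fix y assume "y \<in> {word u * x * word v |u x v. x \<in> I}"
    then obtain u x v where "y = word u * x * word v" "x \<in> I" by auto
    then have "y * word w = word u * x * word (v @ w)" "x \<in> I"
      by (simp_all add: mult.assoc)
    then show "y * word w \<in> two_sided I"
      unfolding two_sided_def by (intro free_alg.span_base) blast
  qed
  then show "x * p \<in> two_sided I"
    by (induction p rule: free_alg_induct)
       (auto simp: distrib_left cscale_mult subspace_two_sided free_alg.subspace_0
         free_alg.subspace_add free_alg.subspace_scale)
qed

text \<open>A generator with a nonempty outer word has degree above \<open>n\<close>, so up to
  degree \<open>n\<close> only the contribution of \<open>I\<close> itself is visible.\<close>

lemma two_sided_low_degree:
  assumes "free_alg.subspace I" "I \<subseteq> tensor_power n" "p \<in> two_sided I"
  shows "\<exists>x\<in>I. \<forall>w. length w \<le> n \<longrightarrow> Poly_Mapping.lookup p w = Poly_Mapping.lookup x w"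
proof -
  define V where "V = {p. \<exists>x\<in>I. \<forall>w. length w \<le> n \<longrightarrow> Poly_Mapping.lookup p w = Poly_Mapping.lookup x w}"
  have "free_alg.subspace V"
  proof (rule free_alg.subspaceI)
    show "0 \<in> V" using free_alg.subspace_0[OF assms(1)] by (auto simp: V_def intro!: bexI[of _ 0])
  next
    fix p q assume "p \<in> V" "q \<in> V"
    then obtain x y where "x \<in> I" "\<forall>w. length w \<le> n \<longrightarrow> Poly_Mapping.lookup p w = Poly_Mapping.lookup x w"
      "y \<in> I" "\<forall>w. length w \<le> n \<longrightarrow> Poly_Mapping.lookup q w = Poly_Mapping.lookup y w"
      by (auto simp: V_def)
    then show "p + q \<in> V"
      using free_alg.subspace_add[OF assms(1)] by (auto simp: V_def lookup_add intro!: bexI[of _ "x + y"])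
  next
    fix c p assume "p \<in> V"
    then obtain x where "x \<in> I" "\<forall>w. length w \<le> n \<longrightarrow> Poly_Mapping.lookup p w = Poly_Mapping.lookup x w"
      by (auto simp: V_def)
    then show "cscale c p \<in> V"
      using free_alg.subspace_scale[OF assms(1)] by (auto simp: V_def intro!: bexI[of _ "cscale c x"])
  qed
  moreover have "word u * x * word v \<in> V" if "x \<in> I" for u x v
  proof (cases "u = [] \<and> v = []")
    case True
    with that show ?thesis by (auto simp: V_def)
  next
    case False
    have "x \<in> tensor_power n" using that assms(2) by auto
    then have deg: "word u * x * word v \<in> tensor_power (length u + n + length v)"
      by (intro mult_in_tensor_power) simp_all
    have "Poly_Mapping.lookup (word u * x * word v) w = 0" if "length w \<le> n" for w
    proof (rule ccontr)
      assume "Poly_Mapping.lookup (word u * x * word v) w \<noteq> 0"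
      then have "length w = length u + n + length v"
        using deg by (auto simp: tensor_power_def in_keys_iff)
      with False that show False by auto
    qed
    then show ?thesis
      using free_alg.subspace_0[OF assms(1)] by (auto simp: V_def intro!: bexI[of _ 0])
  qed
  ultimately have "two_sided I \<subseteq> V"
    unfolding two_sided_def by (intro free_alg.span_minimal) auto
  with assms(3) show ?thesis by (auto simp: V_def)
qed

lemma two_sided_degree:
  assumes "free_alg.subspace I" "I \<subseteq> tensor_power n" "p \<in> two_sided I"
  shows "p \<in> tensor_power n \<Longrightarrow> p \<in> I"
    and "p \<in> tensor_power m \<Longrightarrow> m < n \<Longrightarrow> p = 0"
proof -
  obtain x where x: "x \<in> I" "\<And>w. length w \<le> n \<Longrightarrow> Poly_Mapping.lookup p w = Poly_Mapping.lookup x w"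
    using two_sided_low_degree[OF assms] by auto
  have zero: "Poly_Mapping.lookup y w = 0" if "y \<in> tensor_power m" "length w \<noteq> m" for y :: "'a free_alg" and w m
    using that by (auto simp: tensor_power_def in_keys_iff)
  have xn: "x \<in> tensor_power n" using x(1) assms(2) by auto
  show "p \<in> I" if "p \<in> tensor_power n"
  proof -
    have "Poly_Mapping.lookup p w = Poly_Mapping.lookup x w" for w
      using x(2) zero[OF that] zero[OF xn] by (cases "length w = n") auto
    then have "p = x" by (rule poly_mapping_eqI)
    with x(1) show ?thesis by simp
  qed
  show "p = 0" if "p \<in> tensor_power m" "m < n"
  proof (rule poly_mapping_eqI)
    show "Poly_Mapping.lookup p w = Poly_Mapping.lookup 0 w" for w
      using x(2)[of w] zero[OF that(1), of w] zero[OF xn, of w] that(2)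
      by (cases "length w = m") auto
  qed
qed

lemma genideal_tensor_embed:
  "genideal (tensor_alg_ring T) (tensor_embed T ` I) = wick_class T ` embed_gen ` two_sided I"
proof
  have eq: "tensor_embed T ` I = wick_class T ` embed_gen ` I"
    by (auto simp: tensor_embed_def embed_gen_def)
  have "ideal (wick_class T ` embed_gen ` two_sided I) (tensor_alg_ring T)"
    by (rule ideal_tensor_alg_ringI)
       (auto simp: mult_two_sided free_alg.subspace_0 free_alg.subspace_add subspace_two_sided)
  moreover have "tensor_embed T ` I \<subseteq> wick_class T ` embed_gen ` two_sided I"
    unfolding eq by (intro image_mono subset_two_sided)
  ultimately show "genideal (tensor_alg_ring T) (tensor_embed T ` I)
      \<subseteq> wick_class T ` embed_gen ` two_sided I"
    unfolding genideal_def by (intro Inter_lower) simp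
  show "wick_class T ` embed_gen ` two_sided I \<subseteq> genideal (tensor_alg_ring T) (tensor_embed T ` I)"
    unfolding genideal_def
  proof (rule Inter_greatest)
    fix J assume "J \<in> {J. ideal J (tensor_alg_ring T) \<and> tensor_embed T ` I \<subseteq> J}"
    then have J: "ideal J (tensor_alg_ring T)" and sub: "tensor_embed T ` I \<subseteq> J" by auto
    interpret J: ideal J "tensor_alg_ring T" by (rule J)
    let ?P = "\<lambda>x. wick_class T (embed_gen x) \<in> J"
    have l: "?P (y * x)" if "?P x" for x y
      using J.I_l_closed[OF that, of "wick_class T (embed_gen y)"] by (simp add: embed_gen_mult)
    have r: "?P (x * y)" if "?P x" for x y
      using J.I_r_closed[OF that, of "wick_class T (embed_gen y)"] by (simp add: embed_gen_mult)
    have "free_alg.subspace {x. ?P x}"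
    proof (rule free_alg.subspaceI)
      show "0 \<in> {x. ?P x}" using additive_subgroup.zero_closed[OF J.is_additive_subgroup] by simp
      show "x + y \<in> {x. ?P x}" if "x \<in> {x. ?P x}" "y \<in> {x. ?P x}" for x y
        using additive_subgroup.a_closed[OF J.is_additive_subgroup, of "wick_class T (embed_gen x)" "wick_class T (embed_gen y)"] that by simp
      \<comment> \<open>\<open>J\<close> is only given as a ring ideal; a scalar acts as
        multiplication by the degree-zero element \<open>single 0 c\<close> of the tensor
        algebra.\<close>
      show "cscale c x \<in> {x. ?P x}" if "x \<in> {x. ?P x}" for c x
        using l[of x "Poly_Mapping.single 0 c"] that by (simp add: cscale_conv_mult)
    qed
    moreover have "?P (word u * x * word v)" if "x \<in> I" for u x v
      using that sub eq by (intro l r) auto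
    ultimately have "two_sided I \<subseteq> {x. ?P x}"
      unfolding two_sided_def by (intro free_alg.span_minimal) auto
    then show "wick_class T ` embed_gen ` two_sided I \<subseteq> J" by auto
  qed
qed


section \<open>Wick ideals in terms of annihilation\<close>

lemma embed_gen_exch:
  "embed_gen (exch T i j k) = (\<Sum>l\<in>UNIV. cscale (T i j k l) (word [Gen l]))"
  by (simp add: exch_def flin_sum[OF flin_embed_gen])

lemma wick_relation_eq:
  "wick_relation T i j = word [Adj i] * word [Gen j]
     - ((if i = j then 1 else 0) + (\<Sum>k\<in>UNIV. embed_gen (exch T i j k) * word [Adj k]))"
  by (simp add: wick_relation_def embed_gen_exch sum_distrib_right cscale_mult_left)

definition normal_order :: "'d::finite wick_coeffs \<Rightarrow> 'd \<Rightarrow> 'd free_alg \<Rightarrow> 'd letter free_alg" where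
  "normal_order T i x = embed_gen (annih T i x)
     + (\<Sum>k\<in>UNIV. embed_gen (twist T i k x) * word [Adj k])"

lemma flin_normal_order: "flin (normal_order T i)"
  by (rule flinI)
     (simp_all add: normal_order_def distrib_right sum.distrib cscale_mult
       free_alg.scale_right_distrib free_alg.scale_sum_right)

lemma normal_order_letter_mult:
  "normal_order T i (word [j] * x) = (if i = j then embed_gen x else 0)
     + (\<Sum>k\<in>UNIV. embed_gen (exch T i j k) * normal_order T k x)"
proof -
  have "(\<Sum>m\<in>UNIV. embed_gen (twist T i m (word [j] * x)) * word [Adj m])
      = (\<Sum>m\<in>UNIV. \<Sum>k\<in>UNIV. embed_gen (exch T i j k) * (embed_gen (twist T k m x) * word [Adj m]))"
    by (simp add: twist_letter_mult flin_sum[OF flin_embed_gen] embed_gen_mult sum_distrib_right mult.assoc)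
  also have "\<dots> = (\<Sum>k\<in>UNIV. \<Sum>m\<in>UNIV.
      embed_gen (exch T i j k) * (embed_gen (twist T k m x) * word [Adj m]))"
    by (rule sum.swap)
  finally show ?thesis
    by (simp add: normal_order_def annih_letter_mult flin_sum[OF flin_embed_gen] embed_gen_mult
        distrib_left sum.distrib sum_distrib_left)
qed

text \<open>Each letter that is passed costs multiples of Wick relations, so normal ordering is a
  congruence and not an equality in the free algebra.\<close>

lemma adj_mult_normal_order:
  "word [Adj i] * embed_gen x - normal_order T i x \<in> wick_relation_ideal T"
proof -
  note K = wick_relation_ideal_closed
  have sum_mem: "(\<Sum>k\<in>A. f k) \<in> wick_relation_ideal T"
    if "\<And>k. f k \<in> wick_relation_ideal T" for f and A :: "'a set"
    by (induction A rule: infinite_finite_induct) (auto intro: K that)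
  show ?thesis
  proof (induction x rule: free_alg_induct)
    case (word w)
    show ?case
    proof (induction w arbitrary: i)
      case Nil
      have "normal_order T i 1 = word [Adj i]"
        by (simp add: normal_order_def twist_one if_distrib[of embed_gen]
            if_distrib[of "\<lambda>a. a * _"] cong: if_cong)
      then show ?case by (simp add: K)
    next
      case (Cons j w)
      let ?E = "embed_gen (word w)"
      have "word [Adj i] * embed_gen (word (j # w)) = word [Adj i] * word [Gen j] * ?E"
        by simp
      then have eq: "word [Adj i] * embed_gen (word (j # w)) - normal_order T i (word (j # w))
          = wick_relation T i j * ?E
            + (\<Sum>k\<in>UNIV. embed_gen (exch T i j k) * (word [Adj k] * ?E - normal_order T k (word w)))"
        unfolding word_Cons[of j w] normal_order_letter_mult wick_relation_eq
        by (simp add: algebra_simps sum_subtractf sum_distrib_right sum_distrib_left)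
      show ?case
        unfolding eq
        by (intro K(2) K(5)[OF wick_relation_in_ideal] sum_mem K(4) Cons.IH)
    qed
  next
    case zero
    show ?case using K(1) by (simp add: flin_zero[OF flin_normal_order])
  next
    case (add p q)
    then have "(word [Adj i] * embed_gen p - normal_order T i p)
        + (word [Adj i] * embed_gen q - normal_order T i q) \<in> wick_relation_ideal T"
      by (rule K(2))
    then show ?case by (simp add: flin_add[OF flin_normal_order] algebra_simps)
  next
    case (scale c p)
    from K(7)[OF this, of c] show ?case
      by (simp add: flin_scale[OF flin_normal_order] cscale_mult free_alg.scale_right_diff_distrib)
  qed
qed

text \<open>The product rules make \<open>two_sided I\<close> stable under \<open>annih\<close> and
  \<open>twist\<close>, so normal ordering moves each \<open>Adj i\<close> to the right of the
  ideal.\<close>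

lemma wick_generating_imp_generates:
  fixes T :: "'d::finite wick_coeffs"
  assumes "wick_generating T n I"
  shows "generates_homogeneous_wick_ideal T n I"
proof -
  have I: "free_alg.subspace I" "I \<subseteq> tensor_power n"
    and annih0: "\<And>x i. x \<in> I \<Longrightarrow> annih T i x = 0" and twist: "\<And>x i k. x \<in> I \<Longrightarrow> twist T i k x \<in> I"
    using assms unfolding wick_generating_def by auto
  let ?J = "two_sided I"
  note J = free_alg.subspace_0[OF subspace_two_sided] free_alg.subspace_add[OF subspace_two_sided]
    free_alg.subspace_sum[OF subspace_two_sided] mult_two_sided
  have annih_J: "annih T i x \<in> ?J" and twist_J: "twist T i k x \<in> ?J" if "x \<in> ?J" for i k x
  proof -
    have mem: "annih T i (word u * y * word v) \<in> ?J \<and> twist T i k (word u * y * word v) \<in> ?J"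
      if "y \<in> I" for y u v
    proof -
      have y: "y \<in> ?J" "\<And>i k. twist T i k y \<in> ?J"
        using that twist subset_two_sided by blast+
      \<comment> \<open>The terms with \<open>annih\<close> applied to \<open>y\<close> vanish;
        every other term contains \<open>y\<close> or a twist of \<open>y\<close>.\<close>
      have "annih T i (word u * y) \<in> ?J" "twist T i k (word u * y) \<in> ?J" for i k
        unfolding annih_mult twist_mult annih0[OF that] by (intro J y; simp add: J(1,4) y)+
      then show ?thesis
        unfolding annih_mult[of T i "word u * y"] twist_mult[of T i k "word u * y"]
        by (intro conjI J(2,3,5))
    qed
    show "annih T i x \<in> ?J"
      by (rule span_image_subset[OF flin_annih subspace_two_sided _ that[unfolded two_sided_def]])
         (use mem in auto)
    show "twist T i k x \<in> ?J"
      by (rule span_image_subset[OF flin_twist subspace_two_sided _ that[unfolded two_sided_def]])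
         (use mem in auto)
  qed
  define S where "S = {word [Adj i] | i :: 'd. True}"
  have S: "{wick_class T (word [Adj i]) | i. True} = wick_class T ` S"
    unfolding S_def by auto
  define D where "D = {p. wick_class T p \<in> generated_subalgebra (wick_algebra T) (wick_class T ` S)}"
  note D = generated_subalgebra_closed[where T = T and S = S, folded D_def]
  have dual: "tensor_alg_dual T = wick_class T ` D"
    unfolding tensor_alg_dual_def S by (rule D(1))
  define P where "P = free_alg.span {u * v | u v. u \<in> embed_gen ` ?J \<and> v \<in> D}"
  \<comment> \<open>The saturation of \<open>P\<close> modulo the relations: since normal ordering
    is only a congruence, stability under left multiplication is proved for
    \<open>M\<close>.\<close>
  define M where "M = {p. wick_class T p \<in> wick_class T ` P}"
  have P: "free_alg.subspace P" unfolding P_def by simp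
  have M: "free_alg.subspace M"
    unfolding M_def by (rule subspace_vimage(1)[OF submodule_image[OF P]])
  have PM: "P \<subseteq> M" unfolding M_def by auto
  have congM: "p \<in> M" if "q \<in> M" "p - q \<in> wick_relation_ideal T" for p q
    using that wick_class_eq_iff[of T p q] by (simp add: M_def)
  have congP: "\<exists>q\<in>P. p - q \<in> wick_relation_ideal T" if "p \<in> M" for p
    using that wick_class_eq_iff[of T p] by (auto simp: M_def)
  have gen: "embed_gen x * d \<in> M" if "x \<in> ?J" "d \<in> D" for x d
    using that PM unfolding P_def by (blast intro: free_alg.span_base)
  have adjP: "word [Adj i] * p \<in> M" if "p \<in> P" for i p
  proof (rule span_image_subset[OF flin_mult_left M _ that[unfolded P_def]])
    fix y assume "y \<in> {u * v | u v. u \<in> embed_gen ` ?J \<and> v \<in> D}"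
    then obtain x d where y: "y = embed_gen x * d" "x \<in> ?J" "d \<in> D" by auto
    have "word [Adj k] \<in> D" for k
      using D(5) by (auto simp: S_def)
    then have "normal_order T i x * d \<in> M"
      unfolding normal_order_def distrib_right sum_distrib_right mult.assoc
      using annih_J[OF y(2)] twist_J[OF y(2)] y(3) D(4)
      by (intro free_alg.subspace_add free_alg.subspace_sum M gen) auto
    moreover have "word [Adj i] * y - normal_order T i x * d \<in> wick_relation_ideal T"
      using wick_relation_ideal_closed(5)[OF adj_mult_normal_order[of i x T], of d]
      by (simp add: y(1) left_diff_distrib mult.assoc)
    ultimately show "word [Adj i] * y \<in> M" by (rule congM)
  qed
  have mulM: "r * p \<in> M" if p: "p \<in> M" and r: "\<And>q. q \<in> P \<Longrightarrow> r * q \<in> M" for r p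
  proof -
    obtain q where q: "q \<in> P" "p - q \<in> wick_relation_ideal T" using congP[OF p] by auto
    have "r * p - r * q \<in> wick_relation_ideal T"
      using wick_relation_ideal_closed(4)[OF q(2), of r] by (simp add: right_diff_distrib)
    with r[OF q(1)] show ?thesis by (rule congM)
  qed
  have adjM: "word [Adj i] * p \<in> M" if "p \<in> M" for i p
    by (rule mulM[OF that adjP])
  \<comment> \<open>The left multipliers of \<open>M\<close> form a unital subalgebra containing
    every \<open>Adj i\<close>. By minimality its image contains the dual tensor algebra.\<close>
  define A where "A = {d. \<forall>p\<in>M. d * p \<in> M}"
  have "tensor_alg_dual T \<subseteq> wick_class T ` A"
    unfolding tensor_alg_dual_def S
  proof (rule generated_subalgebra_minimal)
    show "free_alg.subspace A"
      using M unfolding free_alg.subspace_def A_def by (auto simp: distrib_right cscale_mult)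
  qed (auto simp: A_def S_def mult.assoc adjM)
  then have DA: "\<exists>a\<in>A. d - a \<in> wick_relation_ideal T" if "d \<in> D" for d
    using that wick_class_eq_iff[of T d] unfolding dual by blast
  have "d * p \<in> M" if "d \<in> D" "p \<in> embed_gen ` ?J" for d p
  proof -
    obtain a where a: "a \<in> A" "d - a \<in> wick_relation_ideal T" using DA \<open>d \<in> D\<close> by auto
    have "p \<in> M" using that(2) gen[OF _ D(3)] by auto
    then have "a * p \<in> M" using a(1) by (auto simp: A_def)
    moreover have "d * p - a * p \<in> wick_relation_ideal T"
      using wick_relation_ideal_closed(5)[OF a(2), of p] by (simp add: left_diff_distrib)
    ultimately show ?thesis by (rule congM)
  qed
  then have "free_alg.span {u * v | u v. u \<in> D \<and> v \<in> embed_gen ` ?J} \<subseteq> M"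
    by (intro free_alg.span_minimal M) auto
  then have "wick_class T ` free_alg.span {u * v | u v. u \<in> D \<and> v \<in> embed_gen ` ?J} \<subseteq> wick_class T ` P"
    unfolding M_def by auto
  then have "tensor_in (wick_algebra T) (tensor_alg_dual T) (wick_class T ` embed_gen ` ?J)
      \<subseteq> tensor_in (wick_algebra T) (wick_class T ` embed_gen ` ?J) (tensor_alg_dual T)"
    unfolding dual tensor_in_image P_def .
  moreover have "ideal (wick_class T ` embed_gen ` ?J) (tensor_alg_ring T)"
    by (rule ideal_tensor_alg_ringI) (auto intro: J)
  ultimately show ?thesis
    unfolding generates_homogeneous_wick_ideal_def genideal_tensor_embed wick_ideal_def
    using I by simp
qed

text \<open>It is enough to test products with one letter \<open>Adj i\<close> on the left of
  \<open>I\<close>: their components in the module are the values of \<open>annih\<close> and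
  \<open>twist\<close>.\<close>

lemma generates_imp_wick_generating:
  fixes T :: "'d::finite wick_coeffs"
  assumes herm: "hermitian_coeffs T" and "n \<ge> 1" and gen: "generates_homogeneous_wick_ideal T n I"
  shows "wick_generating T n I"
proof -
  have I: "free_alg.subspace I" "I \<subseteq> tensor_power n"
    and wick: "tensor_in (wick_algebra T) (tensor_alg_dual T) (wick_class T ` embed_gen ` two_sided I)
        \<subseteq> tensor_in (wick_algebra T) (wick_class T ` embed_gen ` two_sided I) (tensor_alg_dual T)"
    using gen
    unfolding generates_homogeneous_wick_ideal_def genideal_tensor_embed wick_ideal_def by auto
  let ?J = "two_sided I"
  define S where "S = {word [Adj i] | i :: 'd. True}"
  have S: "{wick_class T (word [Adj i]) | i. True} = wick_class T ` S"
    unfolding S_def by auto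
  define D where "D = {p. wick_class T p \<in> generated_subalgebra (wick_algebra T) (wick_class T ` S)}"
  note D = generated_subalgebra_closed[where T = T and S = S, folded D_def]
  have dual: "tensor_alg_dual T = wick_class T ` D"
    unfolding tensor_alg_dual_def S by (rule D(1))
  \<comment> \<open>The unit in the module; acting on it reads off the parts with no annihilator and
    with exactly one.\<close>
  define vac :: "'d option \<Rightarrow> 'd free_alg" where "vac = (\<lambda>z. if z = None then 1 else 0)"
  \<comment> \<open>\<open>V\<close> contains the ideal times anything: the left factor multiplies
    every component from the left, and \<open>two_sided I\<close> absorbs multiplication from the
    right.\<close>
  define V where "V = {p. \<forall>z. act T p vac z \<in> ?J}"
  have "free_alg.subspace V"
    using subspace_two_sided[of I] unfolding V_def free_alg.subspace_def by auto
  moreover have "embed_gen x * d \<in> V" if "x \<in> ?J" for x d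
    using mult_two_sided(2)[OF that] by (simp add: V_def act_mult act_embed_gen)
  ultimately have V: "free_alg.span {u * v | u v. u \<in> embed_gen ` ?J \<and> v \<in> D} \<subseteq> V"
    by (intro free_alg.span_minimal) auto
  have mem: "act T (word [Adj i] * embed_gen x) vac z \<in> ?J" if "x \<in> I" for i x z
  proof -
    have "word [Adj i] \<in> D" using D(5) by (auto simp: S_def)
    moreover have "x \<in> ?J" using that subset_two_sided by blast
    ultimately have "word [Adj i] * embed_gen x
        \<in> free_alg.span {u * v | u v. u \<in> D \<and> v \<in> embed_gen ` ?J}"
      by (intro free_alg.span_base) blast
    then have "wick_class T (word [Adj i] * embed_gen x)
        \<in> wick_class T ` free_alg.span {u * v | u v. u \<in> embed_gen ` ?J \<and> v \<in> D}"
      using wick unfolding dual tensor_in_image by blast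
    then obtain q where "q \<in> V" and q: "word [Adj i] * embed_gen x - q \<in> wick_relation_ideal T"
      using V wick_class_eq_iff[of T "word [Adj i] * embed_gen x"] by auto
    have "act T (word [Adj i] * embed_gen x) vac z = act T q vac z"
      using act_wick_relation_ideal[OF herm q, of vac z] by simp
    with \<open>q \<in> V\<close> show ?thesis by (simp add: V_def)
  qed
  have "annih T i x = 0" "twist T i k x \<in> I" if "x \<in> I" for i k x
  proof -
    have deg: "x \<in> tensor_power n" using that I(2) by auto
    have act: "act T (word [Adj i] * embed_gen x) vac z
        = (case z of None \<Rightarrow> annih T i x | Some k \<Rightarrow> twist T i k x)" for z
    proof -
      have "act T (embed_gen x) vac = (\<lambda>z. if z = None then x else 0)"
        by (auto simp: act_embed_gen vac_def)
      then show ?thesis by (simp add: act_word_mult split: option.split)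
    qed
    \<comment> \<open>The degree \<open>n - 1\<close> is strictly below \<open>n\<close> because
      \<open>n\<close> is positive, and there the ideal is zero.\<close>
    have "annih T i x \<in> ?J" using mem[OF that, of i None] by (simp add: act)
    then show "annih T i x = 0"
      using two_sided_degree(2)[OF I _ annih_in_tensor_power[OF deg]] \<open>n \<ge> 1\<close> by auto
    have "twist T i k x \<in> ?J" using mem[OF that, of i "Some k"] by (simp add: act)
    then show "twist T i k x \<in> I"
      using two_sided_degree(1)[OF I _ twist_in_tensor_power[OF deg]] by auto
  qed
  with I show ?thesis unfolding wick_generating_def by auto
qed

theorem proposition5:
  fixes T :: "'d::finite wick_coeffs" and n :: nat and I :: "'d free_alg set"
  assumes "hermitian_coeffs T"
    and "braided T"
    and "n \<ge> 2"
    and "generates_homogeneous_wick_ideal T n I"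
  shows "generates_homogeneous_wick_ideal T (n + 1)
           ((\<lambda>x. x - wick_op_prod T n x) ` tensor_prod I (tensor_power 1))"
proof -
  have "wick_generating T n I"
    using assms by (intro generates_imp_wick_generating) auto
  then show ?thesis
    by (intro wick_generating_imp_generates wick_generating_step assms(2))
qed

end
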